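(* Let $(M_1,J,g_1)$ be an almost Hermitian manifold with fundamental 2-form $\Phi_1$, carrying a 1-form $\omega$ with $d\omega=\Phi_1$, and let $(M_2,\phi,\xi,\eta,g_2)$ be an almost contact metric manifold. Let $a\in\mathbb{R}$ and let $f\in C^\infty(M_1,\mathbb{R})$ be a positive function. For $X=(X_1,X_2)$, $Y=(Y_1,Y_2)\in\chi(M_1\times M_2)$ put $$\bar\phi(X_1,X_2)=\bigl(JX_1,\ \phi X_2-a\,\omega(JX_1)\,\xi\bigr),\qquad \bar\eta(X_1,X_2)=a\,\omega(X_1)+\eta(X_2),\qquad \bar\xi=(0,\xi),$$ $$g(X,Y)=g_1(X_1,Y_1)+f^2\bigl(g_2(X_2,Y_2)-\eta(X_2)\eta(Y_2)\bigr)+\bar\eta(X)\,\bar\eta(Y).$$ Then $(M_1\times M_2,\bar\phi,\bar\xi,\bar\eta,g)$ is an almost contact metric manifold.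
   Context: An almost Hermitian manifold $(M_1,J,g_1)$ has $J^2=-\mathrm{id}$ and $g_1(JX,JY)=g_1(X,Y)$; its fundamental 2-form is $\Phi_1(X,Y)=g_1(X,JY)$. The exterior derivative of a 1-form is normalized by $2\,d\omega(X,Y)=X\omega(Y)-Y\omega(X)-\omega([X,Y])$. Vector fields on the product are written $(X_1,X_2)$ with $X_1$ tangent to $M_1$ and $X_2$ tangent to $M_2$; all tensor fields are extended $C^\infty(M_1\times M_2)$-linearly. An almost contact metric manifold $(M,\phi,\xi,\eta,g)$ is an odd-dimensional manifold with a $(1,1)$-tensor field $\phi$, a vector field $\xi$, a 1-form $\eta$ and a Riemannian metric $g$ satisfying $\phi^2X=-X+\eta(X)\xi$, $\eta(\xi)=1$ and $g(\phi X,\phi Y)=g(X,Y)-\eta(X)\eta(Y)$ for all $X,Y\in\chi(M)$. *)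

theory Defs
  imports "HOL-Analysis.Analysis" "HOL-Library.Function_Algebras"
begin

section \<open>Smooth maps between Euclidean spaces\<close>

text \<open>The predicates below are meant for open \<open>S\<close>. \<open>Ck_on k f S\<close> says that all iterated
  directional derivatives of \<open>f\<close> up to order \<open>k\<close> exist and are continuous on \<open>S\<close>, those of order
  less than \<open>k\<close> being moreover (totally) differentiable.\<close>

primrec Ck_on :: "nat \<Rightarrow> ('a::euclidean_space \<Rightarrow> 'b::real_normed_vector) \<Rightarrow> 'a set \<Rightarrow> bool" where
  "Ck_on 0 f S \<longleftrightarrow> continuous_on S f"
| "Ck_on (Suc k) f S \<longleftrightarrow>
     (\<forall>x\<in>S. f differentiable (at x)) \<and> (\<forall>v. Ck_on k (\<lambda>x. frechet_derivative f (at x) v) S)"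

definition smooth_on :: "('a::euclidean_space \<Rightarrow> 'b::real_normed_vector) \<Rightarrow> 'a set \<Rightarrow> bool" where
  "smooth_on f S \<longleftrightarrow> (\<forall>k. Ck_on k f S)"


section \<open>Smooth manifolds\<close>

text \<open>A chart is a pair of its domain and its coordinate map; values of the coordinate map outside
  the domain are irrelevant.\<close>

type_synonym ('a, 'e) chart = "'a set \<times> ('a \<Rightarrow> 'e)"

abbreviation chart_image :: "('a, 'e) chart \<Rightarrow> 'e set" where
  "chart_image c \<equiv> snd c ` fst c"

abbreviation chart_inv :: "('a, 'e) chart \<Rightarrow> 'e \<Rightarrow> 'a" where
  "chart_inv c \<equiv> inv_into (fst c) (snd c)"

definition chart_of :: "'a topology \<Rightarrow> ('a, 'e::euclidean_space) chart \<Rightarrow> bool" where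
  "chart_of X c \<longleftrightarrow> openin X (fst c) \<and> open (chart_image c) \<and>
     homeomorphic_map (subtopology X (fst c)) (top_of_set (chart_image c)) (snd c)"

text \<open>The atlas is not required to be maximal. All notions below give the same result (up to the
  obvious identification of tangent vectors) for an atlas and for the smooth structure that it
  generates.\<close>

record ('a, 'e) mfd =
  topo :: "'a topology"
  atlas :: "('a, 'e) chart set"

abbreviation points :: "('a, 'e) mfd \<Rightarrow> 'a set" where
  "points M \<equiv> topspace (topo M)"

definition charts_at :: "('a, 'e) mfd \<Rightarrow> 'a \<Rightarrow> ('a, 'e) chart set" where
  "charts_at M p = {c \<in> atlas M. p \<in> fst c}"

definition smooth_manifold :: "('a, 'e::euclidean_space) mfd \<Rightarrow> bool" where
  "smooth_manifold M \<longleftrightarrow>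
     Hausdorff_space (topo M) \<and> second_countable (topo M) \<and> points M \<noteq> {} \<and>
     (\<forall>c\<in>atlas M. chart_of (topo M) c) \<and>
     (\<forall>p\<in>points M. charts_at M p \<noteq> {}) \<and>
     (\<forall>c\<in>atlas M. \<forall>c'\<in>atlas M. smooth_on (snd c' \<circ> chart_inv c) (snd c ` (fst c \<inter> fst c')))"

definition prod_chart ::
  "('a, 'e) chart \<Rightarrow> ('b, 'f) chart \<Rightarrow> ('a \<times> 'b, 'e \<times> 'f) chart" where
  "prod_chart c d = (fst c \<times> fst d, map_prod (snd c) (snd d))"

definition prod_mfd :: "('a, 'e) mfd \<Rightarrow> ('b, 'f) mfd \<Rightarrow> ('a \<times> 'b, 'e \<times> 'f) mfd" where
  "prod_mfd M N =
     \<lparr>topo = prod_topology (topo M) (topo N),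
      atlas = {prod_chart c d | c d. c \<in> atlas M \<and> d \<in> atlas N}\<rparr>"

definition smooth_function :: "('a, 'e::euclidean_space) mfd \<Rightarrow> ('a \<Rightarrow> real) \<Rightarrow> bool" where
  "smooth_function M f \<longleftrightarrow> (\<forall>c\<in>atlas M. smooth_on (f \<circ> chart_inv c) (chart_image c))"


section \<open>Tangent vectors\<close>

text \<open>Vector operations on functions are pointwise; addition, zero and subtraction are provided by
  the library, scalar multiplication is added here.\<close>

instantiation "fun" :: (type, real_vector) real_vector
begin

definition scaleR_fun :: "real \<Rightarrow> ('a \<Rightarrow> 'b) \<Rightarrow> 'a \<Rightarrow> 'b" where
  "scaleR_fun r v = (\<lambda>x. r *\<^sub>R v x)"

instance
  by standard (simp_all add: scaleR_fun_def fun_eq_iff algebra_simps)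

end

text \<open>A tangent vector at \<open>p\<close> assigns to every chart around \<open>p\<close> a coordinate vector, where the
  coordinate vectors in two charts correspond under the derivative of the transition map. It is
  set to zero on all other arguments, so that equality of tangent vectors is equality of functions
  and the tangent space is a linear subspace of the function space.\<close>

type_synonym ('a, 'e) tangent = "('a, 'e) chart \<Rightarrow> 'e"

definition transition_deriv ::
  "('a, 'e::euclidean_space) chart \<Rightarrow> ('a, 'e) chart \<Rightarrow> 'a \<Rightarrow> 'e \<Rightarrow> 'e" where
  "transition_deriv c c' p = frechet_derivative (snd c' \<circ> chart_inv c) (at (snd c p))"

definition tangent_space :: "('a, 'e::euclidean_space) mfd \<Rightarrow> 'a \<Rightarrow> ('a, 'e) tangent set" where
  "tangent_space M p =
     {v. (\<forall>c\<in>charts_at M p. \<forall>c'\<in>charts_at M p. v c' = transition_deriv c c' p (v c)) \<and>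
         (\<forall>c. c \<notin> charts_at M p \<longrightarrow> v c = 0)}"

text \<open>The tangent vector at \<open>p\<close> with coordinate vector \<open>e\<close> in the chart \<open>c\<close>: for a basis vector
  \<open>e\<close> this is the coordinate vector field of \<open>c\<close> belonging to \<open>e\<close>.\<close>

definition coord_vec ::
  "('a, 'e::euclidean_space) mfd \<Rightarrow> ('a, 'e) chart \<Rightarrow> 'e \<Rightarrow> 'a \<Rightarrow> ('a, 'e) tangent" where
  "coord_vec M c e p = (\<lambda>c'. if c' \<in> charts_at M p then transition_deriv c c' p e else 0)"

text \<open>The derivative of a real function in the direction of a tangent vector, and the differential
  of a map between manifolds. Neither depends on the chart chosen by \<open>SOME\<close>, as long as the
  function or map is differentiable at \<open>p\<close> and \<open>v\<close> is a tangent vector at \<open>p\<close>.\<close>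

definition dir_deriv ::
  "('a, 'e::euclidean_space) mfd \<Rightarrow> 'a \<Rightarrow> ('a, 'e) tangent \<Rightarrow> ('a \<Rightarrow> real) \<Rightarrow> real" where
  "dir_deriv M p v f =
     (let c = (SOME c. c \<in> charts_at M p)
      in frechet_derivative (f \<circ> chart_inv c) (at (snd c p)) (v c))"

definition differential ::
  "('a, 'e::euclidean_space) mfd \<Rightarrow> ('b, 'f::euclidean_space) mfd \<Rightarrow> ('a \<Rightarrow> 'b) \<Rightarrow> 'a \<Rightarrow>
     ('a, 'e) tangent \<Rightarrow> ('b, 'f) tangent" where
  "differential M N F p v =
     (let c = (SOME c. c \<in> charts_at M p)
      in (\<lambda>d. if d \<in> charts_at N (F p)
              then frechet_derivative (snd d \<circ> F \<circ> chart_inv c) (at (snd c p)) (v c) else 0))"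


section \<open>Tensor fields\<close>

text \<open>A tensor field is given by its values on tangent vectors at each point of the manifold (its
  values elsewhere are irrelevant); it is smooth if its components in every chart of the atlas
  are.\<close>

definition vector_field ::
  "('a, 'e::euclidean_space) mfd \<Rightarrow> ('a \<Rightarrow> ('a, 'e) tangent) \<Rightarrow> bool" where
  "vector_field M V \<longleftrightarrow>
     (\<forall>p\<in>points M. V p \<in> tangent_space M p) \<and>
     (\<forall>c\<in>atlas M. smooth_on (\<lambda>x. V (chart_inv c x) c) (chart_image c))"

definition one_form ::
  "('a, 'e::euclidean_space) mfd \<Rightarrow> ('a \<Rightarrow> ('a, 'e) tangent \<Rightarrow> real) \<Rightarrow> bool" where
  "one_form M \<omega> \<longleftrightarrow>
     (\<forall>p\<in>points M. \<forall>v\<in>tangent_space M p. \<forall>w\<in>tangent_space M p. \<forall>r.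
        \<omega> p (v + w) = \<omega> p v + \<omega> p w \<and> \<omega> p (r *\<^sub>R v) = r * \<omega> p v) \<and>
     (\<forall>c\<in>atlas M. \<forall>e. smooth_on (\<lambda>x. \<omega> (chart_inv c x) (coord_vec M c e (chart_inv c x)))
        (chart_image c))"

definition endo_field ::
  "('a, 'e::euclidean_space) mfd \<Rightarrow> ('a \<Rightarrow> ('a, 'e) tangent \<Rightarrow> ('a, 'e) tangent) \<Rightarrow> bool"
  \<comment> \<open>tensor fields of type \<open>(1,1)\<close>\<close>
  where
  "endo_field M A \<longleftrightarrow>
     (\<forall>p\<in>points M. \<forall>v\<in>tangent_space M p. \<forall>w\<in>tangent_space M p. \<forall>r.
        A p v \<in> tangent_space M p \<and>
        A p (v + w) = A p v + A p w \<and> A p (r *\<^sub>R v) = r *\<^sub>R A p v) \<and>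
     (\<forall>c\<in>atlas M. \<forall>e. smooth_on (\<lambda>x. A (chart_inv c x) (coord_vec M c e (chart_inv c x)) c)
        (chart_image c))"

definition riemannian_metric ::
  "('a, 'e::euclidean_space) mfd \<Rightarrow> ('a \<Rightarrow> ('a, 'e) tangent \<Rightarrow> ('a, 'e) tangent \<Rightarrow> real) \<Rightarrow> bool" where
  "riemannian_metric M g \<longleftrightarrow>
     (\<forall>p\<in>points M. \<forall>u\<in>tangent_space M p. \<forall>v\<in>tangent_space M p. \<forall>w\<in>tangent_space M p. \<forall>r.
        g p (u + v) w = g p u w + g p v w \<and> g p (r *\<^sub>R u) w = r * g p u w \<and>
        g p u v = g p v u) \<and>
     (\<forall>p\<in>points M. \<forall>v\<in>tangent_space M p. v \<noteq> 0 \<longrightarrow> g p v v > 0) \<and>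
     (\<forall>c\<in>atlas M. \<forall>e e'. smooth_on
        (\<lambda>x. g (chart_inv c x) (coord_vec M c e (chart_inv c x)) (coord_vec M c e' (chart_inv c x)))
        (chart_image c))"

text \<open>In coordinates, \<open>[V, W]\<^sup>i = V\<^sup>j \<partial>\<^sub>j W\<^sup>i - W\<^sup>j \<partial>\<^sub>j V\<^sup>i\<close>.\<close>

definition lie_bracket ::
  "('a, 'e::euclidean_space) mfd \<Rightarrow> ('a \<Rightarrow> ('a, 'e) tangent) \<Rightarrow> ('a \<Rightarrow> ('a, 'e) tangent) \<Rightarrow>
     'a \<Rightarrow> ('a, 'e) tangent" where
  "lie_bracket M V W p =
     (\<lambda>c. if c \<in> charts_at M p
          then frechet_derivative (\<lambda>x. W (chart_inv c x) c) (at (snd c p)) (V p c)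
             - frechet_derivative (\<lambda>x. V (chart_inv c x) c) (at (snd c p)) (W p c)
          else 0)"

text \<open>The exterior derivative of a 1-form, evaluated on two vector fields, with the normalization
  \<open>2 d\<omega>(V, W) = V \<omega>(W) - W \<omega>(V) - \<omega>([V, W])\<close>.\<close>

definition ext_deriv ::
  "('a, 'e::euclidean_space) mfd \<Rightarrow> ('a \<Rightarrow> ('a, 'e) tangent \<Rightarrow> real) \<Rightarrow>
     ('a \<Rightarrow> ('a, 'e) tangent) \<Rightarrow> ('a \<Rightarrow> ('a, 'e) tangent) \<Rightarrow> 'a \<Rightarrow> real" where
  "ext_deriv M \<omega> V W p =
     (dir_deriv M p (V p) (\<lambda>q. \<omega> q (W q)) - dir_deriv M p (W p) (\<lambda>q. \<omega> q (V q))
        - \<omega> p (lie_bracket M V W p)) / 2"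


section \<open>Almost Hermitian and almost contact metric manifolds\<close>

text \<open>The identities between tensor fields are required in every tangent space.\<close>

definition almost_hermitian ::
  "('a, 'e::euclidean_space) mfd \<Rightarrow> ('a \<Rightarrow> ('a, 'e) tangent \<Rightarrow> ('a, 'e) tangent) \<Rightarrow>
     ('a \<Rightarrow> ('a, 'e) tangent \<Rightarrow> ('a, 'e) tangent \<Rightarrow> real) \<Rightarrow> bool" where
  "almost_hermitian M J g \<longleftrightarrow>
     smooth_manifold M \<and> endo_field M J \<and> riemannian_metric M g \<and>
     (\<forall>p\<in>points M. \<forall>v\<in>tangent_space M p. J p (J p v) = - v) \<and>
     (\<forall>p\<in>points M. \<forall>v\<in>tangent_space M p. \<forall>w\<in>tangent_space M p.
        g p (J p v) (J p w) = g p v w)"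

definition fundamental_form ::
  "('a \<Rightarrow> ('a, 'e) tangent \<Rightarrow> ('a, 'e) tangent) \<Rightarrow>
     ('a \<Rightarrow> ('a, 'e) tangent \<Rightarrow> ('a, 'e) tangent \<Rightarrow> real) \<Rightarrow>
     'a \<Rightarrow> ('a, 'e) tangent \<Rightarrow> ('a, 'e) tangent \<Rightarrow> real" where
  "fundamental_form J g p v w = g p v (J p w)"

definition almost_contact_metric ::
  "('a, 'e::euclidean_space) mfd \<Rightarrow> ('a \<Rightarrow> ('a, 'e) tangent \<Rightarrow> ('a, 'e) tangent) \<Rightarrow>
     ('a \<Rightarrow> ('a, 'e) tangent) \<Rightarrow> ('a \<Rightarrow> ('a, 'e) tangent \<Rightarrow> real) \<Rightarrow>
     ('a \<Rightarrow> ('a, 'e) tangent \<Rightarrow> ('a, 'e) tangent \<Rightarrow> real) \<Rightarrow> bool" where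
  "almost_contact_metric M \<phi> \<xi> \<eta> g \<longleftrightarrow>
     smooth_manifold M \<and> odd DIM('e) \<and>
     endo_field M \<phi> \<and> vector_field M \<xi> \<and> one_form M \<eta> \<and> riemannian_metric M g \<and>
     (\<forall>p\<in>points M. \<forall>v\<in>tangent_space M p. \<phi> p (\<phi> p v) = - v + \<eta> p v *\<^sub>R \<xi> p) \<and>
     (\<forall>p\<in>points M. \<eta> p (\<xi> p) = 1) \<and>
     (\<forall>p\<in>points M. \<forall>v\<in>tangent_space M p. \<forall>w\<in>tangent_space M p.
        g p (\<phi> p v) (\<phi> p w) = g p v w - \<eta> p v * \<eta> p w)"


section \<open>The structure on the product\<close>

text \<open>The decomposition of tangent vectors of the product: \<open>v\<close> at \<open>z\<close> has the components
  \<open>proj1 M N z v\<close> and \<open>proj2 M N z v\<close>, and \<open>tangent_pair M N z v1 v2\<close> is the tangent vector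
  \<open>(v1, v2)\<close>, i.e. the sum of the images of \<open>v1\<close>, \<open>v2\<close> under the differentials of the inclusions
  of the two slices through \<open>z\<close>.\<close>

definition proj1 ::
  "('a, 'e::euclidean_space) mfd \<Rightarrow> ('b, 'f::euclidean_space) mfd \<Rightarrow> 'a \<times> 'b \<Rightarrow>
     ('a \<times> 'b, 'e \<times> 'f) tangent \<Rightarrow> ('a, 'e) tangent" where
  "proj1 M N z = differential (prod_mfd M N) M fst z"

definition proj2 ::
  "('a, 'e::euclidean_space) mfd \<Rightarrow> ('b, 'f::euclidean_space) mfd \<Rightarrow> 'a \<times> 'b \<Rightarrow>
     ('a \<times> 'b, 'e \<times> 'f) tangent \<Rightarrow> ('b, 'f) tangent" where
  "proj2 M N z = differential (prod_mfd M N) N snd z"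

definition tangent_pair ::
  "('a, 'e::euclidean_space) mfd \<Rightarrow> ('b, 'f::euclidean_space) mfd \<Rightarrow> 'a \<times> 'b \<Rightarrow>
     ('a, 'e) tangent \<Rightarrow> ('b, 'f) tangent \<Rightarrow> ('a \<times> 'b, 'e \<times> 'f) tangent" where
  "tangent_pair M N z v1 v2 =
     differential M (prod_mfd M N) (\<lambda>x. (x, snd z)) (fst z) v1
     + differential N (prod_mfd M N) (\<lambda>y. (fst z, y)) (snd z) v2"

definition phi_bar ::
  "('a, 'e::euclidean_space) mfd \<Rightarrow> ('b, 'f::euclidean_space) mfd \<Rightarrow> real \<Rightarrow>
     ('a \<Rightarrow> ('a, 'e) tangent \<Rightarrow> real) \<Rightarrow> ('a \<Rightarrow> ('a, 'e) tangent \<Rightarrow> ('a, 'e) tangent) \<Rightarrow>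
     ('b \<Rightarrow> ('b, 'f) tangent \<Rightarrow> ('b, 'f) tangent) \<Rightarrow> ('b \<Rightarrow> ('b, 'f) tangent) \<Rightarrow>
     'a \<times> 'b \<Rightarrow> ('a \<times> 'b, 'e \<times> 'f) tangent \<Rightarrow> ('a \<times> 'b, 'e \<times> 'f) tangent" where
  "phi_bar M N a \<omega> J \<phi> \<xi> z v =
     (let p = fst z; q = snd z; v1 = proj1 M N z v; v2 = proj2 M N z v
      in tangent_pair M N z (J p v1) (\<phi> q v2 - (a * \<omega> p (J p v1)) *\<^sub>R \<xi> q))"

definition xi_bar ::
  "('a, 'e::euclidean_space) mfd \<Rightarrow> ('b, 'f::euclidean_space) mfd \<Rightarrow> ('b \<Rightarrow> ('b, 'f) tangent) \<Rightarrow>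
     'a \<times> 'b \<Rightarrow> ('a \<times> 'b, 'e \<times> 'f) tangent" where
  "xi_bar M N \<xi> z = tangent_pair M N z 0 (\<xi> (snd z))"

definition eta_bar ::
  "('a, 'e::euclidean_space) mfd \<Rightarrow> ('b, 'f::euclidean_space) mfd \<Rightarrow> real \<Rightarrow>
     ('a \<Rightarrow> ('a, 'e) tangent \<Rightarrow> real) \<Rightarrow> ('b \<Rightarrow> ('b, 'f) tangent \<Rightarrow> real) \<Rightarrow>
     'a \<times> 'b \<Rightarrow> ('a \<times> 'b, 'e \<times> 'f) tangent \<Rightarrow> real" where
  "eta_bar M N a \<omega> \<eta> z v = a * \<omega> (fst z) (proj1 M N z v) + \<eta> (snd z) (proj2 M N z v)"

definition g_bar ::
  "('a, 'e::euclidean_space) mfd \<Rightarrow> ('b, 'f::euclidean_space) mfd \<Rightarrow> real \<Rightarrow> ('a \<Rightarrow> real) \<Rightarrow>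
     ('a \<Rightarrow> ('a, 'e) tangent \<Rightarrow> real) \<Rightarrow> ('b \<Rightarrow> ('b, 'f) tangent \<Rightarrow> real) \<Rightarrow>
     ('a \<Rightarrow> ('a, 'e) tangent \<Rightarrow> ('a, 'e) tangent \<Rightarrow> real) \<Rightarrow>
     ('b \<Rightarrow> ('b, 'f) tangent \<Rightarrow> ('b, 'f) tangent \<Rightarrow> real) \<Rightarrow>
     'a \<times> 'b \<Rightarrow> ('a \<times> 'b, 'e \<times> 'f) tangent \<Rightarrow> ('a \<times> 'b, 'e \<times> 'f) tangent \<Rightarrow> real" where
  "g_bar M N a f \<omega> \<eta> g1 g2 z v w =
     (let p = fst z; q = snd z;
          v1 = proj1 M N z v; v2 = proj2 M N z v; w1 = proj1 M N z w; w2 = proj2 M N z w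
      in g1 p v1 w1 + (f p)\<^sup>2 * (g2 q v2 w2 - \<eta> q v2 * \<eta> q w2)
         + eta_bar M N a \<omega> \<eta> z v * eta_bar M N a \<omega> \<eta> z w)"

end

(* A tangent vector of the product is a pair (v1, v2), and both projections, their linearity and the
   smoothness of a tensor field can be read off in product charts. The tensor identities are then
   pointwise algebra that uses only phi xi = 0 and eta o phi = 0. Positivity of the metric follows from
     g(v, v) = g1(v1, v1) + f^2 g2(phi v2, phi v2) + eta_bar(v)^2,
   as phi v2 = 0 makes v2 a multiple of xi. The dimension of the product is odd because the complex
   structure J on a tangent space of M1 forces its dimension to be even. *)

theory Submission
  imports Defs
begin

section \<open>Calculus of smooth maps\<close>

text \<open>The correction \<open>- a \<omega>(J X1) \<xi>\<close> in \<open>phi_bar\<close> is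
  forced by \<open>eta_bar\<close>: applying \<open>eta_bar\<close> to
  \<open>(J X1, \<phi> X2 + k \<xi>)\<close> gives \<open>a \<omega>(J X1) + k\<close>, which has to
  vanish. Applied twice, the inner correction is killed by \<open>\<phi> \<xi> = 0\<close>, while
  the outer one becomes \<open>- a \<omega>(J (J X1)) \<xi> = a \<omega>(X1) \<xi>\<close>. This is
  exactly the part of \<open>eta_bar(X) xi_bar\<close> that \<open>\<phi>\<close> alone does not
  supply. The analytic obstacle is that smoothness of a tensor field is tested on coordinate fields
  with constant coefficients. The projections to the factors preserve such fields, but
  \<open>J\<close> turns them into fields with variable coefficients, so the smoothness of
  \<open>\<omega>(J X1)\<close> has to be derived by expansion in a basis. A second obstacle is the
  encoding of the projections and inclusions as differentials computed in a chart picked by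
  \<open>SOME\<close>. The choice is harmless because the transition maps between product charts
  have block diagonal derivatives.\<close>

lemma Ck_on_cong:
  assumes "open S" "\<And>x. x \<in> S \<Longrightarrow> f x = g x"
  shows "Ck_on k f S \<longleftrightarrow> Ck_on k g S"
  using assms(2)
proof (induction k arbitrary: f g)
  case 0
  then show ?case by (simp cong: continuous_on_cong)
next
  case (Suc k)
  \<comment> \<open>\<open>S\<close> is open, so agreement on \<open>S\<close> is agreement near
    \<open>x\<close>, and both functions have the same derivatives there.\<close>
  have tr: "(h differentiable at x) = (h' differentiable at x)"
    if "\<And>y. y \<in> S \<Longrightarrow> h y = h' y" "x \<in> S" for x and h h' :: "'a \<Rightarrow> 'b"
    unfolding differentiable_def
    using has_derivative_transform_within_open[OF _ assms(1) \<open>x \<in> S\<close>] that(1)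
    by metis
  show ?case
  proof (cases "\<forall>x\<in>S. f differentiable (at x)")
    case True
    have "frechet_derivative f (at x) = frechet_derivative g (at x)" if "x \<in> S" for x
      using frechet_derivative_transform_within_open[OF _ assms(1) that] True Suc.prems that by metis
    then have "Ck_on k (\<lambda>x. frechet_derivative f (at x) v) S \<longleftrightarrow>
        Ck_on k (\<lambda>x. frechet_derivative g (at x) v) S" for v
      by (intro Suc.IH) simp
    then show ?thesis using tr[of f g] Suc.prems by simp
  next
    case False
    then show ?thesis using tr[of f g] Suc.prems by auto
  qed
qed

text \<open>The base case is that differentiability implies continuity. The product rule needs this
  monotonicity, because there each summand keeps one factor undifferentiated.\<close>

lemma Ck_on_Suc_imp: "Ck_on (Suc k) f S \<Longrightarrow> Ck_on k f S"
proof (induction k arbitrary: f)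
  case 0
  then show ?case
    by (auto intro!: continuous_at_imp_continuous_on differentiable_imp_continuous_within)
next
  case (Suc k)
  then show ?case by (metis Ck_on.simps(2))
qed

text \<open>Derivatives at a point are unique, so an explicit formula \<open>f'\<close> may stand in
  for \<open>frechet_derivative\<close> on the open set. The inductions for linear maps, sums and
  bilinear products take their step through this rule.\<close>

lemma Ck_on_SucI:
  assumes "open S"
    and "\<And>x. x \<in> S \<Longrightarrow> (f has_derivative f' x) (at x)"
    and "\<And>v. Ck_on k (\<lambda>x. f' x v) S"
  shows "Ck_on (Suc k) f S"
proof -
  have "frechet_derivative f (at x) = f' x" if "x \<in> S" for x
    using frechet_derivative_at[OF assms(2)[OF that]] by simp
  then have "Ck_on k (\<lambda>x. frechet_derivative f (at x) v) S" for v
    using assms(3)[of v] by (subst Ck_on_cong[OF assms(1), where g = "\<lambda>x. f' x v"]) auto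
  then show ?thesis
    using assms(2) by (auto simp: differentiable_def)
qed

lemma Ck_on_Suc_derivative:
  assumes "Ck_on (Suc k) f S" "x \<in> S"
  shows "(f has_derivative frechet_derivative f (at x)) (at x)"
  using assms frechet_derivative_works by auto

lemma Ck_on_const: "Ck_on k (\<lambda>x. c) S"
  by (induction k arbitrary: c) auto

lemma Ck_on_compose_bounded_linear:
  assumes "bounded_linear L" "open S" "Ck_on k f S"
  shows "Ck_on k (\<lambda>x. L (f x)) S"
  using assms(3)
proof (induction k arbitrary: f)
  case 0
  then show ?case using bounded_linear.continuous_on[OF assms(1)] by auto
next
  case (Suc k)
  show ?case
    by (rule Ck_on_SucI[OF assms(2)
          bounded_linear.has_derivative[OF assms(1) Ck_on_Suc_derivative[OF Suc.prems]]])
      (use Suc in auto)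
qed

text \<open>The derivative in direction \<open>v\<close> is that of \<open>f\<close> in the fixed
  direction \<open>L v\<close>, again composed with \<open>L\<close>, so the induction closes. It is
  applied to the two projections of a product of coordinate domains.\<close>

lemma Ck_on_compose_linear_right:
  assumes "bounded_linear L" "open T" "L ` T \<subseteq> S" "Ck_on k f S"
  shows "Ck_on k (\<lambda>x. f (L x)) T"
  using assms(4)
proof (induction k arbitrary: f)
  case 0
  then show ?case
    using continuous_on_compose2[OF _ linear_continuous_on[OF assms(1)] assms(3)] by auto
next
  case (Suc k)
  have "((\<lambda>x. f (L x)) has_derivative (\<lambda>v. frechet_derivative f (at (L x)) (L v))) (at x)"
    if "x \<in> T" for x
    using diff_chain_at[OF bounded_linear_imp_has_derivative[OF assms(1)]
        Ck_on_Suc_derivative[OF Suc.prems]] that assms(3)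
    unfolding o_def by blast
  then show ?case
    by (rule Ck_on_SucI[OF assms(2)]) (use Suc in auto)
qed

lemma Ck_on_add:
  assumes "open S" "Ck_on k f S" "Ck_on k g S"
  shows "Ck_on k (\<lambda>x. f x + g x) S"
  using assms(2,3)
proof (induction k arbitrary: f g)
  case 0
  then show ?case by (auto intro: continuous_on_add)
next
  case (Suc k)
  show ?case
    by (rule Ck_on_SucI[OF assms(1) has_derivative_add
          [OF Ck_on_Suc_derivative[OF Suc.prems(1)] Ck_on_Suc_derivative[OF Suc.prems(2)]]])
      (use Suc in auto)
qed

text \<open>By the Leibniz rule a directional derivative is a sum of two products, to which the
  induction hypothesis applies once \<open>Ck_on_Suc_imp\<close> has lowered the order of the
  undifferentiated factors.\<close>

lemma (in bounded_bilinear) Ck_on_bilinear: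
  fixes f :: "'d::euclidean_space \<Rightarrow> 'a"
  assumes "open S" "Ck_on k f S" "Ck_on k g S"
  shows "Ck_on k (\<lambda>x. prod (f x) (g x)) S"
  using assms(2,3)
proof (induction k arbitrary: f g)
  case 0
  then show ?case by (auto intro: continuous_on)
next
  case (Suc k)
  show ?case
    by (rule Ck_on_SucI[OF assms(1) FDERIV
          [OF Ck_on_Suc_derivative[OF Suc.prems(1)] Ck_on_Suc_derivative[OF Suc.prems(2)]]])
      (assumption, assumption, intro Ck_on_add[OF assms(1)] Suc.IH,
        use Suc.prems Ck_on_Suc_imp[OF Suc.prems(1)] Ck_on_Suc_imp[OF Suc.prems(2)] in auto)
qed

section \<open>Closure properties of smooth functions\<close>

lemma smooth_on_cong:
  "open S \<Longrightarrow> (\<And>x. x \<in> S \<Longrightarrow> f x = g x) \<Longrightarrow> smooth_on f S \<longleftrightarrow> smooth_on g S"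
  unfolding smooth_on_def using Ck_on_cong by metis

lemma smooth_on_const: "smooth_on (\<lambda>x. c) S"
  by (simp add: smooth_on_def Ck_on_const)

lemma smooth_on_compose_bounded_linear:
  "bounded_linear L \<Longrightarrow> open S \<Longrightarrow> smooth_on f S \<Longrightarrow> smooth_on (\<lambda>x. L (f x)) S"
  unfolding smooth_on_def using Ck_on_compose_bounded_linear by metis

lemma smooth_on_add:
  "open S \<Longrightarrow> smooth_on f S \<Longrightarrow> smooth_on g S \<Longrightarrow> smooth_on (\<lambda>x. f x + g x) S"
  unfolding smooth_on_def using Ck_on_add by metis

lemma smooth_on_scaleR:
  "open S \<Longrightarrow> smooth_on f S \<Longrightarrow> smooth_on g S \<Longrightarrow> smooth_on (\<lambda>x. f x *\<^sub>R g x) S"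
  unfolding smooth_on_def using bounded_bilinear.Ck_on_bilinear[OF bounded_bilinear_scaleR] by metis

lemma smooth_on_mult:
  fixes f g :: "'a::euclidean_space \<Rightarrow> real"
  shows "open S \<Longrightarrow> smooth_on f S \<Longrightarrow> smooth_on g S \<Longrightarrow> smooth_on (\<lambda>x. f x * g x) S"
  using smooth_on_scaleR[of S f g] by simp

lemma smooth_on_diff:
  assumes "open S" "smooth_on f S" "smooth_on g S"
  shows "smooth_on (\<lambda>x. f x - g x) S"
  using smooth_on_add[OF assms(1,2) smooth_on_compose_bounded_linear
      [OF bounded_linear_minus[OF bounded_linear_ident] assms(1,3)]] by simp

lemma smooth_on_sum:
  assumes "open S" "\<And>i. i \<in> I \<Longrightarrow> smooth_on (f i) S"
  shows "smooth_on (\<lambda>x. \<Sum>i\<in>I. f i x) S"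
  using assms(2)
  by (induction I rule: infinite_finite_induct)
    (auto intro: smooth_on_add[OF assms(1)] simp: smooth_on_const)

text \<open>The pair is the sum of the images of \<open>f\<close> and \<open>g\<close> under the
  linear embeddings of the two factors.\<close>

lemma smooth_on_Pair:
  fixes f :: "'a::euclidean_space \<Rightarrow> 'b::real_normed_vector"
    and g :: "'a \<Rightarrow> 'c::real_normed_vector"
  assumes "open S" "smooth_on f S" "smooth_on g S"
  shows "smooth_on (\<lambda>x. (f x, g x)) S"
proof -
  have "bounded_linear (\<lambda>u::'b. (u, 0::'c))" "bounded_linear (\<lambda>u::'c. (0::'b, u))"
    by (auto intro: bounded_linear_Pair bounded_linear_ident bounded_linear_zero)
  from smooth_on_add[OF assms(1) smooth_on_compose_bounded_linear[OF this(1) assms(1,2)]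
      smooth_on_compose_bounded_linear[OF this(2) assms(1,3)]]
  show ?thesis by simp
qed

lemma smooth_on_compose_linear_right:
  "bounded_linear L \<Longrightarrow> open T \<Longrightarrow> L ` T \<subseteq> S \<Longrightarrow> smooth_on f S \<Longrightarrow> smooth_on (\<lambda>x. f (L x)) T"
  unfolding smooth_on_def using Ck_on_compose_linear_right by metis

lemma smooth_on_fst:
  fixes f :: "'a::euclidean_space \<Rightarrow> 'b::real_normed_vector" and B :: "'c::euclidean_space set"
  assumes "smooth_on f A" "open A" "open B"
  shows "smooth_on (\<lambda>z. f (fst z)) (A \<times> B)"
  using assms by (intro smooth_on_compose_linear_right[OF bounded_linear_fst, of _ A]) (auto intro: open_Times)

lemma smooth_on_snd:
  fixes f :: "'a::euclidean_space \<Rightarrow> 'b::real_normed_vector" and B :: "'c::euclidean_space set"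
  assumes "smooth_on f A" "open A" "open B"
  shows "smooth_on (\<lambda>z. f (snd z)) (B \<times> A)"
  using assms by (intro smooth_on_compose_linear_right[OF bounded_linear_snd, of _ A]) (auto intro: open_Times)

lemma smooth_on_has_derivative:
  "smooth_on f S \<Longrightarrow> x \<in> S \<Longrightarrow> (f has_derivative frechet_derivative f (at x)) (at x)"
  unfolding smooth_on_def using Ck_on_Suc_derivative by blast

section \<open>Complex structures on vector spaces\<close>

text \<open>A \<open>J\<close>-invariant subspace \<open>T \<noteq> UNIV\<close> can be enlarged by \<open>v\<close> and \<open>J v\<close> for any \<open>v\<close> outside
  \<open>T\<close>, which raises the dimension by two.\<close>

lemma even_dimension_of_complex_structure:
  fixes J :: "'e::euclidean_space \<Rightarrow> 'e"
  assumes "linear J" and JJ: "\<And>v. J (J v) = - v"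
  shows "even DIM('e)"
proof -
  let ?P = "\<lambda>T. subspace T \<and> J ` T \<subseteq> T \<and> even (dim T)"
  have "?P {0}" using linear_0[OF assms(1)] by (simp add: subspace_single_0)
  \<comment> \<open>Dimensions are at most \<open>DIM('e)\<close>; the bound in the rule is strict,
    hence the successor. The subspace \<open>{0}\<close> is the witness that there is something to
    maximise.\<close>
  then have "\<exists>T. ?P T \<and> (\<forall>T'. ?P T' \<longrightarrow> dim T' \<le> dim T)"
    by (rule ex_has_greatest_nat[where b = "Suc DIM('e)"]) (simp add: dim_subset_UNIV less_Suc_eq_le)
  then obtain T where T: "?P T" and max: "\<And>T'. ?P T' \<Longrightarrow> dim T' \<le> dim T"
    by blast
  have "T = UNIV"
  proof (rule ccontr)
    assume "T \<noteq> UNIV"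
    then obtain v where v: "v \<notin> T" by auto
    have span_T: "span T = T" using T by (simp add: span_eq_iff)
    have Jv: "J v \<notin> span (insert v T)"
    proof
      assume "J v \<in> span (insert v T)"
      then obtain c where c: "J v - c *\<^sub>R v \<in> T"
        using span_T by (auto simp: span_breakdown_eq)
      \<comment> \<open>Modulo \<open>T\<close> the vector \<open>v\<close> would be an eigenvector
        with real eigenvalue \<open>c\<close>. Applying \<open>J + c\<close> to
        \<open>J v - c v\<close> cancels the mixed terms and leaves
        \<open>J (J v) - c^2 v = - (1 + c^2) v\<close>, whose coefficient is never zero.\<close>
      then have "J (J v - c *\<^sub>R v) + c *\<^sub>R (J v - c *\<^sub>R v) \<in> T"
        using T by (intro subspace_add subspace_scale) auto
      moreover have "J (J v - c *\<^sub>R v) + c *\<^sub>R (J v - c *\<^sub>R v) = - (1 + c\<^sup>2) *\<^sub>R v"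
        by (simp add: linear_diff[OF assms(1)] linear_cmul[OF assms(1)] JJ algebra_simps
            power2_eq_square)
      ultimately have "(- 1 / (1 + c\<^sup>2)) *\<^sub>R (- (1 + c\<^sup>2) *\<^sub>R v) \<in> T"
        using T by (metis subspace_scale)
      moreover have "1 + c\<^sup>2 \<noteq> 0" by (smt (verit) zero_le_power2)
      then have "(- 1 / (1 + c\<^sup>2)) * - (1 + c\<^sup>2) = 1" by (simp add: field_simps)
      ultimately show False using v by (simp only: scaleR_scaleR scaleR_one)
    qed
    let ?B = "insert (J v) (insert v T)"
    have "dim ?B = dim T + 2"
      using v Jv by (simp only: dim_insert span_T) simp
    moreover have "J ` ?B \<subseteq> span ?B"
      using T JJ span_base[of _ ?B] span_neg[OF span_base, of v ?B] by auto
    then have "J ` span ?B \<subseteq> span ?B"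
      by (metis linear_span_image[OF assms(1)] span_minimal subspace_span)
    ultimately show False
      using max[of "span ?B"] T by simp
  qed
  then show ?thesis using T dim_UNIV by metis
qed

section \<open>Charts and tangent spaces\<close>

lemma subtopology_chart_topspace:
  "chart_of X c \<Longrightarrow> topspace (subtopology X (fst c)) = fst c"
  by (auto simp: chart_of_def dest: openin_subset)

lemma atlas_chart_of: "smooth_manifold M \<Longrightarrow> c \<in> atlas M \<Longrightarrow> chart_of (topo M) c"
  by (simp add: smooth_manifold_def)

lemma chart_inj_on: "smooth_manifold M \<Longrightarrow> c \<in> atlas M \<Longrightarrow> inj_on (snd c) (fst c)"
  using subtopology_chart_topspace[OF atlas_chart_of[of M c]] atlas_chart_of[of M c]
  by (metis chart_of_def homeomorphic_imp_injective_map)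

lemma chart_inv_chart:
  "smooth_manifold M \<Longrightarrow> c \<in> atlas M \<Longrightarrow> p \<in> fst c \<Longrightarrow> chart_inv c (snd c p) = p"
  using chart_inj_on by (metis inv_into_f_f)

lemma open_chart_image: "smooth_manifold M \<Longrightarrow> c \<in> atlas M \<Longrightarrow> open (chart_image c)"
  using atlas_chart_of chart_of_def by metis

lemma chart_domain_subset: "smooth_manifold M \<Longrightarrow> c \<in> atlas M \<Longrightarrow> fst c \<subseteq> points M"
  using atlas_chart_of by (metis chart_of_def openin_subset)

lemma charts_at_iff: "c \<in> charts_at M p \<longleftrightarrow> c \<in> atlas M \<and> p \<in> fst c"
  by (simp add: charts_at_def)

lemma charts_at_chart_inv:
  "c \<in> atlas M \<Longrightarrow> x \<in> chart_image c \<Longrightarrow> c \<in> charts_at M (chart_inv c x)"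
  by (simp add: charts_at_iff inv_into_into)

lemma charts_at_nonempty:
  "smooth_manifold M \<Longrightarrow> p \<in> points M \<Longrightarrow> \<exists>c. c \<in> charts_at M p"
  unfolding smooth_manifold_def by blast

lemma charts_at_imp_points: "smooth_manifold M \<Longrightarrow> c \<in> charts_at M p \<Longrightarrow> p \<in> points M"
  using chart_domain_subset[of M c] by (auto simp: charts_at_iff)

text \<open>A chart is a homeomorphism onto its image, hence maps the overlap to a set open in that
  image; the image is itself open in the Euclidean space. Derivatives of transition maps can
  therefore be computed locally on this set.\<close>

lemma open_chart_overlap:
  assumes "smooth_manifold M" "c \<in> atlas M" "c' \<in> atlas M"
  shows "open (snd c ` (fst c \<inter> fst c'))"
proof -
  have c: "chart_of (topo M) c" "chart_of (topo M) c'"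
    by (simp_all add: assms atlas_chart_of)
  then have "openin (subtopology (topo M) (fst c)) (fst c \<inter> fst c')"
    by (auto simp: chart_of_def openin_subtopology_Int2)
  moreover have "open_map (subtopology (topo M) (fst c)) (top_of_set (chart_image c)) (snd c)"
    using c(1) by (auto simp: chart_of_def intro: homeomorphic_imp_open_map)
  ultimately have "openin (top_of_set (chart_image c)) (snd c ` (fst c \<inter> fst c'))"
    by (auto simp: open_map_def)
  then show ?thesis
    using c(1) by (auto simp: chart_of_def openin_open_eq)
qed

lemma transition_has_derivative:
  assumes "smooth_manifold M" "c \<in> charts_at M p" "c' \<in> charts_at M p"
  shows "((\<lambda>x. snd c' (chart_inv c x)) has_derivative transition_deriv c c' p) (at (snd c p))"
proof -
  have "smooth_on (snd c' \<circ> chart_inv c) (snd c ` (fst c \<inter> fst c'))"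
    using assms unfolding charts_at_iff smooth_manifold_def by blast
  moreover have "snd c p \<in> snd c ` (fst c \<inter> fst c')"
    using assms(2,3) by (simp add: charts_at_iff)
  ultimately show ?thesis
    using smooth_on_has_derivative by (fastforce simp: transition_deriv_def o_def)
qed

lemma transition_linear:
  assumes "smooth_manifold M" "c \<in> charts_at M p" "c' \<in> charts_at M p"
  shows "linear (transition_deriv c c' p)"
  using has_derivative_linear[OF transition_has_derivative[OF assms]] .

lemma transition_deriv_self:
  assumes "smooth_manifold M" "c \<in> charts_at M p"
  shows "transition_deriv c c p e = e"
proof -
  have "(snd c \<circ> chart_inv c has_derivative (\<lambda>e. e)) (at (snd c p))"
    by (rule has_derivative_transform_within_open[OF has_derivative_ident
          open_chart_image[of M c]])
      (use assms in \<open>auto simp: charts_at_iff f_inv_into_f\<close>)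
  then show ?thesis
    unfolding transition_deriv_def using frechet_derivative_at by metis
qed

lemma transition_deriv_compose:
  assumes M: "smooth_manifold M"
    and c: "c \<in> charts_at M p" "c' \<in> charts_at M p" "c'' \<in> charts_at M p"
  shows "transition_deriv c' c'' p (transition_deriv c c' p e) = transition_deriv c c'' p e"
proof -
  have p: "(snd c' \<circ> chart_inv c) (snd c p) = snd c' p"
    using chart_inv_chart[OF M] c by (simp add: charts_at_iff)
  have "((snd c'' \<circ> chart_inv c') \<circ> (snd c' \<circ> chart_inv c) has_derivative
      transition_deriv c' c'' p \<circ> transition_deriv c c' p) (at (snd c p))"
    using transition_has_derivative[OF M c(1,2)] transition_has_derivative[OF M c(2,3)] p
    by (intro diff_chain_at) (auto simp: o_def)
  \<comment> \<open>The middle chart cancels only on the overlap of \<open>c\<close> and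
    \<open>c'\<close>, where \<open>chart_inv c'\<close> undoes \<open>snd c'\<close>; its image is
    an open neighbourhood of \<open>snd c p\<close>, which is enough for the derivative.\<close>
  then have "(snd c'' \<circ> chart_inv c has_derivative
      transition_deriv c' c'' p \<circ> transition_deriv c c' p) (at (snd c p))"
    by (rule has_derivative_transform_within_open[OF _ open_chart_overlap[OF M, of c c']])
      (use c chart_inv_chart[OF M] in \<open>auto simp: charts_at_iff\<close>)
  then have "transition_deriv c c'' p = transition_deriv c' c'' p \<circ> transition_deriv c c' p"
    unfolding transition_deriv_def[of c c''] using frechet_derivative_at by metis
  then show ?thesis by simp
qed

section \<open>Tangent spaces and coordinate vectors\<close>

lemma tangent_spaceI:
  "(\<And>c c'. c \<in> charts_at M p \<Longrightarrow> c' \<in> charts_at M p \<Longrightarrow> v c' = transition_deriv c c' p (v c)) \<Longrightarrow>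
    (\<And>c. c \<notin> charts_at M p \<Longrightarrow> v c = 0) \<Longrightarrow> v \<in> tangent_space M p"
  unfolding tangent_space_def by blast

lemma tangent_space_transition:
  "v \<in> tangent_space M p \<Longrightarrow> c \<in> charts_at M p \<Longrightarrow> c' \<in> charts_at M p \<Longrightarrow>
    v c' = transition_deriv c c' p (v c)"
  unfolding tangent_space_def by blast

lemma tangent_space_off_charts:
  "v \<in> tangent_space M p \<Longrightarrow> c \<notin> charts_at M p \<Longrightarrow> v c = 0"
  unfolding tangent_space_def by blast

text \<open>The transition derivatives recover all coordinates from those in one chart, and away
  from the charts at \<open>p\<close> both vectors are zero by convention. This reduces equations
  between tangent vectors to a single, conveniently chosen chart.\<close>

lemma tangent_space_eqI:
  assumes "v \<in> tangent_space M p" "w \<in> tangent_space M p" "c \<in> charts_at M p" "v c = w c"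
  shows "v = w"
proof
  fix c'
  show "v c' = w c'"
    using assms(4) tangent_space_transition[OF assms(1,3), of c']
      tangent_space_off_charts[OF assms(1), of c'] tangent_space_transition[OF assms(2,3), of c']
      tangent_space_off_charts[OF assms(2), of c']
    by (cases "c' \<in> charts_at M p") simp_all
qed

lemma coord_vec_apply:
  "smooth_manifold M \<Longrightarrow> c \<in> charts_at M p \<Longrightarrow> coord_vec M c e p c = e"
  by (simp add: coord_vec_def transition_deriv_self)

text \<open>Compatibility between two charts is the cocycle rule
  \<open>transition_deriv_compose\<close> with \<open>c\<close> as the common source.\<close>

lemma coord_vec_tangent_space:
  "smooth_manifold M \<Longrightarrow> c \<in> charts_at M p \<Longrightarrow> coord_vec M c e p \<in> tangent_space M p"
  by (rule tangent_spaceI) (simp_all add: coord_vec_def transition_deriv_compose)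

lemma subspace_tangent_space:
  assumes "smooth_manifold M"
  shows "subspace (tangent_space M p)"
proof -
  note L = transition_linear[OF assms]
  have "0 \<in> tangent_space M p"
    by (rule tangent_spaceI) (simp_all add: linear_0[OF L])
  moreover have "v + w \<in> tangent_space M p"
    if v: "v \<in> tangent_space M p" and w: "w \<in> tangent_space M p" for v w
  proof (rule tangent_spaceI)
    show "(v + w) c' = transition_deriv c c' p ((v + w) c)"
      if "c \<in> charts_at M p" "c' \<in> charts_at M p" for c c'
      using tangent_space_transition[OF v that] tangent_space_transition[OF w that]
      by (simp add: linear_add[OF L[OF that]])
  qed (simp add: tangent_space_off_charts[OF v] tangent_space_off_charts[OF w])
  moreover have "r *\<^sub>R v \<in> tangent_space M p" if v: "v \<in> tangent_space M p" for r v
  proof (rule tangent_spaceI)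
    show "(r *\<^sub>R v) c' = transition_deriv c c' p ((r *\<^sub>R v) c)"
      if "c \<in> charts_at M p" "c' \<in> charts_at M p" for c c'
      using tangent_space_transition[OF v that]
      by (simp add: scaleR_fun_def linear_cmul[OF L[OF that]])
  qed (simp add: scaleR_fun_def tangent_space_off_charts[OF v])
  ultimately show ?thesis by (simp add: subspace_def)
qed

lemma linear_coord_vec:
  assumes "smooth_manifold M" "c \<in> charts_at M p"
  shows "linear (\<lambda>e. coord_vec M c e p)"
proof -
  note T = coord_vec_tangent_space[OF assms] subspace_tangent_space[OF assms(1)]
  have "coord_vec M c (e + e') p = coord_vec M c e p + coord_vec M c e' p" for e e'
    by (rule tangent_space_eqI[OF _ _ assms(2)])
      (auto simp: T subspace_add coord_vec_apply[OF assms])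
  moreover have "coord_vec M c (r *\<^sub>R e) p = r *\<^sub>R coord_vec M c e p" for r e
    by (rule tangent_space_eqI[OF _ _ assms(2)])
      (simp_all add: T subspace_scale, simp_all add: scaleR_fun_def coord_vec_apply[OF assms])
  ultimately show ?thesis by (rule linearI)
qed

section \<open>The product of two manifolds\<close>

text \<open>Boxes of basic open sets form a countable base: every open neighbourhood contains an
  open box, and each side of the box can be shrunk to a basic set.\<close>

lemma second_countable_prod_topology:
  assumes "second_countable X" "second_countable Y"
  shows "second_countable (prod_topology X Y)"
proof -
  obtain \<B> \<C> where B: "countable \<B>" "\<And>V. V \<in> \<B> \<Longrightarrow> openin X V"
      "\<And>U x. openin X U \<Longrightarrow> x \<in> U \<Longrightarrow> \<exists>V \<in> \<B>. x \<in> V \<and> V \<subseteq> U"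
    and C: "countable \<C>" "\<And>V. V \<in> \<C> \<Longrightarrow> openin Y V"
      "\<And>U x. openin Y U \<Longrightarrow> x \<in> U \<Longrightarrow> \<exists>V \<in> \<C>. x \<in> V \<and> V \<subseteq> U"
    using assms unfolding second_countable_def by metis
  let ?D = "(\<lambda>(U, V). U \<times> V) ` (\<B> \<times> \<C>)"
  show ?thesis
    unfolding second_countable_def
  proof (intro exI[of _ ?D] conjI allI impI ballI)
    show "countable ?D" using B(1) C(1) by auto
    show "openin (prod_topology X Y) V" if "V \<in> ?D" for V
      using that B(2) C(2) by (auto simp: openin_prod_Times_iff)
    show "\<exists>V\<in>?D. z \<in> V \<and> V \<subseteq> W" if W: "openin (prod_topology X Y) W \<and> z \<in> W" for W z
    proof -
      obtain x y where z: "z = (x, y)" by force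
      have "\<exists>U V. openin X U \<and> openin Y V \<and> x \<in> U \<and> y \<in> V \<and> U \<times> V \<subseteq> W"
        using W z by (simp add: openin_prod_topology_alt)
      then obtain U V where "openin X U" "openin Y V" "x \<in> U" "y \<in> V" and UV: "U \<times> V \<subseteq> W"
        by blast
      then obtain U' V' where "U' \<in> \<B>" "x \<in> U'" "U' \<subseteq> U" "V' \<in> \<C>" "y \<in> V'" "V' \<subseteq> V"
        using B(3)[of U x] C(3)[of V y] by blast
      then show ?thesis
        using UV z by (intro bexI[of _ "U' \<times> V'"]) auto
    qed
  qed
qed

lemma fst_prod_chart [simp]: "fst (prod_chart c d) = fst c \<times> fst d"
  and snd_prod_chart [simp]: "snd (prod_chart c d) = map_prod (snd c) (snd d)"
  by (simp_all add: prod_chart_def)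

lemma chart_image_prod_chart: "chart_image (prod_chart c d) = chart_image c \<times> chart_image d"
  by (auto simp: image_iff)

lemma points_prod_mfd: "points (prod_mfd M N) = points M \<times> points N"
  by (simp add: prod_mfd_def)

lemma atlas_prod_mfd:
  "C \<in> atlas (prod_mfd M N) \<longleftrightarrow> (\<exists>c\<in>atlas M. \<exists>d\<in>atlas N. C = prod_chart c d)"
  by (auto simp: prod_mfd_def)

lemma ball_atlas_prod_mfd:
  "(\<forall>C\<in>atlas (prod_mfd M N). Q C) \<longleftrightarrow> (\<forall>c\<in>atlas M. \<forall>d\<in>atlas N. Q (prod_chart c d))"
  unfolding Ball_def atlas_prod_mfd by blast

lemma charts_at_prod_mfd:
  "C \<in> charts_at (prod_mfd M N) z \<longleftrightarrow>
    (\<exists>c\<in>charts_at M (fst z). \<exists>d\<in>charts_at N (snd z). C = prod_chart c d)"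
proof
  assume "C \<in> charts_at (prod_mfd M N) z"
  then obtain c d where "c \<in> atlas M" "d \<in> atlas N" "C = prod_chart c d" "z \<in> fst C"
    unfolding charts_at_iff atlas_prod_mfd by blast
  then show "\<exists>c\<in>charts_at M (fst z). \<exists>d\<in>charts_at N (snd z). C = prod_chart c d"
    by (intro bexI[of _ c] bexI[of _ d]) (simp_all add: charts_at_iff mem_Times_iff)
next
  assume "\<exists>c\<in>charts_at M (fst z). \<exists>d\<in>charts_at N (snd z). C = prod_chart c d"
  then obtain c d where "c \<in> charts_at M (fst z)" "d \<in> charts_at N (snd z)" "C = prod_chart c d"
    by blast
  then show "C \<in> charts_at (prod_mfd M N) z"
    unfolding charts_at_iff atlas_prod_mfd by (simp add: mem_Times_iff) blast
qed

lemma prod_chart_charts_at: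
  "c \<in> charts_at M (fst z) \<Longrightarrow> d \<in> charts_at N (snd z) \<Longrightarrow>
    prod_chart c d \<in> charts_at (prod_mfd M N) z"
  unfolding charts_at_prod_mfd by blast

context
  fixes M :: "('a, 'e::euclidean_space) mfd" and N :: "('b, 'f::euclidean_space) mfd"
  assumes M: "smooth_manifold M" and N: "smooth_manifold N"
begin

text \<open>The left side is the form to which the simp rules for \<open>prod_chart\<close> reduce
  \<open>chart_inv (prod_chart c d)\<close>, so the equation works as a rewrite rule after
  them.\<close>

lemma chart_inv_prod_chart:
  assumes "c \<in> atlas M" "d \<in> atlas N" "w \<in> chart_image c \<times> chart_image d"
  shows "inv_into (fst c \<times> fst d) (map_prod (snd c) (snd d)) w = (chart_inv c (fst w), chart_inv d (snd w))"
proof -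
  obtain p q where pq: "p \<in> fst c" "q \<in> fst d" "w = (snd c p, snd d q)"
    using assms(3) by auto
  have "inj_on (map_prod (snd c) (snd d)) (fst c \<times> fst d)"
    using map_prod_inj_on[OF chart_inj_on[OF M assms(1)] chart_inj_on[OF N assms(2)]] .
  from inv_into_f_f[OF this, of "(p, q)"] show ?thesis
    using pq chart_inv_chart[OF M assms(1)] chart_inv_chart[OF N assms(2)] by simp
qed

text \<open>Overlaps of boxes are boxes of overlaps, and on such a box the transition map acts on
  each factor separately; smoothness is inherited through the two projections.\<close>

lemma smooth_on_prod_transition:
  assumes "c \<in> atlas M" "c' \<in> atlas M" "d \<in> atlas N" "d' \<in> atlas N"
  shows "smooth_on (snd (prod_chart c' d') \<circ> chart_inv (prod_chart c d))
    (snd (prod_chart c d) ` (fst (prod_chart c d) \<inter> fst (prod_chart c' d')))"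
proof -
  let ?A = "snd c ` (fst c \<inter> fst c')" and ?B = "snd d ` (fst d \<inter> fst d')"
  have set: "snd (prod_chart c d) ` (fst (prod_chart c d) \<inter> fst (prod_chart c' d')) = ?A \<times> ?B"
    by (auto simp: image_iff)
  note op = open_chart_overlap[OF M assms(1,2)] open_chart_overlap[OF N assms(3,4)]
  have "smooth_on (snd c' \<circ> chart_inv c) ?A" "smooth_on (snd d' \<circ> chart_inv d) ?B"
    using M N assms unfolding smooth_manifold_def by blast+
  from smooth_on_Pair[OF open_Times[OF op] smooth_on_fst[OF this(1) op] smooth_on_snd[OF this(2) op(2,1)]]
  show ?thesis
    unfolding set
    by (subst smooth_on_cong[OF open_Times[OF op]]) (auto simp: chart_inv_prod_chart assms)
qed

lemma chart_of_prod_chart: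
  assumes "c \<in> atlas M" "d \<in> atlas N"
  shows "chart_of (prod_topology (topo M) (topo N)) (prod_chart c d)"
proof -
  have c: "chart_of (topo M) c" "chart_of (topo N) d"
    by (simp_all add: assms M N atlas_chart_of)
  obtain f' g' where
    "homeomorphic_maps (subtopology (topo M) (fst c)) (top_of_set (chart_image c)) (snd c) f'"
    "homeomorphic_maps (subtopology (topo N) (fst d)) (top_of_set (chart_image d)) (snd d) g'"
    using c unfolding chart_of_def homeomorphic_map_maps by blast
  then have "homeomorphic_maps
      (prod_topology (subtopology (topo M) (fst c)) (subtopology (topo N) (fst d)))
      (prod_topology (top_of_set (chart_image c)) (top_of_set (chart_image d)))
      (\<lambda>(x, y). (snd c x, snd d y)) (\<lambda>(x, y). (f' x, g' y))"
    unfolding homeomorphic_maps_prod by blast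
  then have "homeomorphic_map (subtopology (prod_topology (topo M) (topo N)) (fst c \<times> fst d))
      (top_of_set (chart_image c \<times> chart_image d)) (map_prod (snd c) (snd d))"
    unfolding homeomorphic_map_maps map_prod_def by (auto simp: subtopology_Times)
  then show ?thesis
    using c unfolding chart_of_def chart_image_prod_chart
    by (auto simp: openin_prod_Times_iff open_Times)
qed

lemma prod_charts_exist:
  assumes "z \<in> points (prod_mfd M N)"
  obtains c d where "c \<in> charts_at M (fst z)" "d \<in> charts_at N (snd z)"
proof -
  have "fst z \<in> points M" "snd z \<in> points N"
    using assms by (simp_all add: points_prod_mfd mem_Times_iff)
  then show thesis
    using that charts_at_nonempty[OF M] charts_at_nonempty[OF N] by blast
qed

lemma smooth_manifold_prod_mfd: "smooth_manifold (prod_mfd M N)"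
proof -
  have "Hausdorff_space (topo (prod_mfd M N))" "second_countable (topo (prod_mfd M N))"
    using M[unfolded smooth_manifold_def] N[unfolded smooth_manifold_def]
    by (simp_all only: prod_mfd_def mfd.simps Hausdorff_space_prod_topology
        second_countable_prod_topology simp_thms)
  moreover have "points (prod_mfd M N) \<noteq> {}"
    using M[unfolded smooth_manifold_def] N[unfolded smooth_manifold_def]
    by (simp only: points_prod_mfd Times_empty simp_thms)
  moreover have "chart_of (topo (prod_mfd M N)) C" if "C \<in> atlas (prod_mfd M N)" for C
    using that chart_of_prod_chart unfolding atlas_prod_mfd by (auto simp only: prod_mfd_def mfd.simps)
  moreover have "charts_at (prod_mfd M N) z \<noteq> {}" if "z \<in> points (prod_mfd M N)" for z
    using prod_charts_exist[OF that] prod_chart_charts_at[of _ M z _ N] by blast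
  moreover have "smooth_on (snd C' \<circ> chart_inv C) (snd C ` (fst C \<inter> fst C'))"
    if "C \<in> atlas (prod_mfd M N)" "C' \<in> atlas (prod_mfd M N)" for C C'
    using that smooth_on_prod_transition unfolding atlas_prod_mfd by blast
  ultimately show ?thesis unfolding smooth_manifold_def by blast
qed

section \<open>Splitting of the tangent spaces of the product\<close>

lemma transition_deriv_prod_chart:
  assumes "c \<in> charts_at M (fst z)" "c' \<in> charts_at M (fst z)"
    and "d \<in> charts_at N (snd z)" "d' \<in> charts_at N (snd z)"
  shows "transition_deriv (prod_chart c d) (prod_chart c' d') z e =
    (transition_deriv c c' (fst z) (fst e), transition_deriv d d' (snd z) (snd e))"
proof -
  let ?z = "snd (prod_chart c d) z"
  have z: "fst ?z = snd c (fst z)" "snd ?z = snd d (snd z)"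
    by (cases z; simp)+
  \<comment> \<open>The transition map is replaced by a map that is visibly a product, whose
    derivative is block diagonal; the two agree on the open chart image.\<close>
  have "((\<lambda>w. (snd c' (chart_inv c (fst w)), snd d' (chart_inv d (snd w)))) has_derivative
      (\<lambda>e. (transition_deriv c c' (fst z) (fst e), transition_deriv d d' (snd z) (snd e)))) (at ?z)"
    using transition_has_derivative[OF M assms(1,2)] transition_has_derivative[OF N assms(3,4)] z
    by (intro has_derivative_Pair
        has_derivative_compose[OF has_derivative_fst[OF has_derivative_ident]]
        has_derivative_compose[OF has_derivative_snd[OF has_derivative_ident]]) auto
  then have "(snd (prod_chart c' d') \<circ> chart_inv (prod_chart c d) has_derivative
      (\<lambda>e. (transition_deriv c c' (fst z) (fst e), transition_deriv d d' (snd z) (snd e)))) (at ?z)"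
  proof (rule has_derivative_transform_within_open)
    show "open (chart_image c \<times> chart_image d)"
      using assms by (intro open_Times open_chart_image[OF M] open_chart_image[OF N])
        (simp_all add: charts_at_iff)
    show "?z \<in> chart_image c \<times> chart_image d"
      using assms z by (simp add: charts_at_iff mem_Times_iff)
    show "(snd c' (chart_inv c (fst w)), snd d' (chart_inv d (snd w))) =
        (snd (prod_chart c' d') \<circ> chart_inv (prod_chart c d)) w"
      if "w \<in> chart_image c \<times> chart_image d" for w
      using assms that by (simp add: charts_at_iff chart_inv_prod_chart)
  qed
  from frechet_derivative_at[OF this, symmetric] show ?thesis
    by (simp only: transition_deriv_def[of "prod_chart c d"])
qed

text \<open>This removes the \<open>SOME\<close> from \<open>proj1\<close> and \<open>proj2\<close>.
  In the chosen chart the projection is differentiated explicitly, and the block diagonal transition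
  to \<open>prod_chart c d\<close> turns the coordinates of \<open>v\<close> there into the stated
  ones.\<close>

lemma proj_apply:
  assumes v: "v \<in> tangent_space (prod_mfd M N) z"
    and c: "c \<in> charts_at M (fst z)" and d: "d \<in> charts_at N (snd z)"
  shows "proj1 M N z v c = fst (v (prod_chart c d))"
    and "proj2 M N z v d = snd (v (prod_chart c d))"
proof -
  define C where "C = (SOME C. C \<in> charts_at (prod_mfd M N) z)"
  have "C \<in> charts_at (prod_mfd M N) z"
    unfolding C_def using prod_chart_charts_at[OF c d] by (rule someI)
  \<comment> \<open>Whatever \<open>SOME\<close> picks is a product chart, since the atlas of the
    product consists of such charts.\<close>
  then obtain c0 d0 where c0: "c0 \<in> charts_at M (fst z)" and d0: "d0 \<in> charts_at N (snd z)"
    and C: "C = prod_chart c0 d0" unfolding charts_at_prod_mfd by blast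
  let ?z = "snd C z"
  have z: "fst ?z = snd c0 (fst z)" "snd ?z = snd d0 (snd z)"
    by (cases z; simp add: C)+
  have op: "open (chart_image c0 \<times> chart_image d0)" and inz: "?z \<in> chart_image c0 \<times> chart_image d0"
    using c0 d0 z by (auto simp: charts_at_iff mem_Times_iff
        intro!: open_Times open_chart_image[OF M] open_chart_image[OF N])
  have v_eq: "v (prod_chart c d) =
      (transition_deriv c0 c (fst z) (fst (v C)), transition_deriv d0 d (snd z) (snd (v C)))"
    using tangent_space_transition[OF v prod_chart_charts_at[OF c0 d0] prod_chart_charts_at[OF c d]]
      transition_deriv_prod_chart[OF c0 c d0 d] C by simp
  have "((\<lambda>w. snd c (chart_inv c0 (fst w))) has_derivative
      (\<lambda>e. transition_deriv c0 c (fst z) (fst e))) (at ?z)"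
    using transition_has_derivative[OF M c0 c] z
    by (intro has_derivative_compose[OF has_derivative_fst[OF has_derivative_ident]]) auto
  then have "(snd c \<circ> fst \<circ> chart_inv C has_derivative
      (\<lambda>e. transition_deriv c0 c (fst z) (fst e))) (at ?z)"
    by (rule has_derivative_transform_within_open[OF _ op inz])
      (use c0 d0 in \<open>auto simp: C charts_at_iff chart_inv_prod_chart\<close>)
  then show "proj1 M N z v c = fst (v (prod_chart c d))"
    unfolding proj1_def differential_def Let_def C_def[symmetric]
    using c v_eq by (auto simp: frechet_derivative_at[symmetric])
  have "((\<lambda>w. snd d (chart_inv d0 (snd w))) has_derivative
      (\<lambda>e. transition_deriv d0 d (snd z) (snd e))) (at ?z)"
    using transition_has_derivative[OF N d0 d] z
    by (intro has_derivative_compose[OF has_derivative_snd[OF has_derivative_ident]]) auto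
  then have "(snd d \<circ> snd \<circ> chart_inv C has_derivative
      (\<lambda>e. transition_deriv d0 d (snd z) (snd e))) (at ?z)"
    by (rule has_derivative_transform_within_open[OF _ op inz])
      (use c0 d0 in \<open>auto simp: C charts_at_iff chart_inv_prod_chart\<close>)
  then show "proj2 M N z v d = snd (v (prod_chart c d))"
    unfolding proj2_def differential_def Let_def C_def[symmetric]
    using d v_eq by (auto simp: frechet_derivative_at[symmetric])
qed

lemma proj_tangent_space:
  assumes z: "z \<in> points (prod_mfd M N)" and v: "v \<in> tangent_space (prod_mfd M N) z"
  shows "proj1 M N z v \<in> tangent_space M (fst z)"
    and "proj2 M N z v \<in> tangent_space N (snd z)"
proof -
  obtain c d where c: "c \<in> charts_at M (fst z)" and d: "d \<in> charts_at N (snd z)"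
    using prod_charts_exist[OF z] .
  \<comment> \<open>The chart \<open>d\<close> on the second factor stays fixed, so the first
    components of the product coordinates change by the transition of the first factor.\<close>
  have "proj1 M N z v c'' = transition_deriv c' c'' (fst z) (proj1 M N z v c')"
    if "c' \<in> charts_at M (fst z)" "c'' \<in> charts_at M (fst z)" for c' c''
    using tangent_space_transition[OF v prod_chart_charts_at[OF that(1) d]
        prod_chart_charts_at[OF that(2) d]]
      transition_deriv_prod_chart[OF that d d] proj_apply[OF v that(1) d] proj_apply[OF v that(2) d]
    by simp
  moreover have "proj1 M N z v c' = 0" if "c' \<notin> charts_at M (fst z)" for c'
    using that by (simp add: proj1_def differential_def Let_def)
  ultimately show "proj1 M N z v \<in> tangent_space M (fst z)"
    by (rule tangent_spaceI)
  have "proj2 M N z v d'' = transition_deriv d' d'' (snd z) (proj2 M N z v d')"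
    if "d' \<in> charts_at N (snd z)" "d'' \<in> charts_at N (snd z)" for d' d''
    using tangent_space_transition[OF v prod_chart_charts_at[OF c that(1)]
        prod_chart_charts_at[OF c that(2)]]
      transition_deriv_prod_chart[OF c c that] proj_apply[OF v c that(1)] proj_apply[OF v c that(2)]
    by simp
  moreover have "proj2 M N z v d' = 0" if "d' \<notin> charts_at N (snd z)" for d'
    using that by (simp add: proj2_def differential_def Let_def)
  ultimately show "proj2 M N z v \<in> tangent_space N (snd z)"
    by (rule tangent_spaceI)
qed

text \<open>In product charts a slice inclusion has one constant component, so its differential
  embeds one factor and is zero in the other. The sum of the two embeddings puts the coordinates
  side by side, whichever charts \<open>SOME\<close> picks.\<close>

lemma tangent_pair_apply:
  assumes v: "v1 \<in> tangent_space M (fst z)" "v2 \<in> tangent_space N (snd z)"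
    and c: "c \<in> charts_at M (fst z)" and d: "d \<in> charts_at N (snd z)"
  shows "tangent_pair M N z v1 v2 (prod_chart c d) = (v1 c, v2 d)"
proof -
  define c0 where "c0 = (SOME c. c \<in> charts_at M (fst z))"
  define d0 where "d0 = (SOME d. d \<in> charts_at N (snd z))"
  have c0: "c0 \<in> charts_at M (fst z)" unfolding c0_def using c by (rule someI)
  have d0: "d0 \<in> charts_at N (snd z)" unfolding d0_def using d by (rule someI)
  have "(snd (prod_chart c d) \<circ> (\<lambda>x. (x, snd z)) \<circ> chart_inv c0 has_derivative
      (\<lambda>e. (transition_deriv c0 c (fst z) e, 0))) (at (snd c0 (fst z)))"
    using has_derivative_Pair[OF transition_has_derivative[OF M c0 c] has_derivative_const]
    by (simp add: o_def)
  then have 1: "differential M (prod_mfd M N) (\<lambda>x. (x, snd z)) (fst z) v1 (prod_chart c d) = (v1 c, 0)"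
    unfolding differential_def Let_def c0_def[symmetric]
    using prod_chart_charts_at[OF c d] tangent_space_transition[OF v(1) c0 c]
    by (auto simp: frechet_derivative_at[symmetric])
  have "(snd (prod_chart c d) \<circ> (\<lambda>y. (fst z, y)) \<circ> chart_inv d0 has_derivative
      (\<lambda>e. (0, transition_deriv d0 d (snd z) e))) (at (snd d0 (snd z)))"
    using has_derivative_Pair[OF has_derivative_const transition_has_derivative[OF N d0 d]]
    by (simp add: o_def)
  then have 2: "differential N (prod_mfd M N) (\<lambda>y. (fst z, y)) (snd z) v2 (prod_chart c d) = (0, v2 d)"
    unfolding differential_def Let_def d0_def[symmetric]
    using prod_chart_charts_at[OF c d] tangent_space_transition[OF v(2) d0 d]
    by (auto simp: frechet_derivative_at[symmetric])
  show ?thesis by (simp add: tangent_pair_def 1 2)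
qed

lemma tangent_pair_tangent_space:
  assumes v: "v1 \<in> tangent_space M (fst z)" "v2 \<in> tangent_space N (snd z)"
  shows "tangent_pair M N z v1 v2 \<in> tangent_space (prod_mfd M N) z"
proof -
  have "tangent_pair M N z v1 v2 C' = transition_deriv C C' z (tangent_pair M N z v1 v2 C)"
    if CC': "C \<in> charts_at (prod_mfd M N) z" "C' \<in> charts_at (prod_mfd M N) z" for C C'
  proof -
    obtain c d c' d' where c: "c \<in> charts_at M (fst z)" "c' \<in> charts_at M (fst z)"
      and d: "d \<in> charts_at N (snd z)" "d' \<in> charts_at N (snd z)"
      and C: "C = prod_chart c d" "C' = prod_chart c' d'"
      using CC' unfolding charts_at_prod_mfd by blast
    show ?thesis
      using tangent_space_transition[OF v(1) c] tangent_space_transition[OF v(2) d]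
      by (simp add: C tangent_pair_apply[OF v] c d transition_deriv_prod_chart)
  qed
  moreover have "tangent_pair M N z v1 v2 C = 0" if "C \<notin> charts_at (prod_mfd M N) z" for C
    using that by (simp add: tangent_pair_def differential_def Let_def)
  ultimately show ?thesis by (rule tangent_spaceI)
qed

context
  fixes z assumes z: "z \<in> points (prod_mfd M N)"
begin

lemma proj_tangent_pair:
  assumes v: "v1 \<in> tangent_space M (fst z)" "v2 \<in> tangent_space N (snd z)"
  shows "proj1 M N z (tangent_pair M N z v1 v2) = v1"
    and "proj2 M N z (tangent_pair M N z v1 v2) = v2"
proof -
  obtain c d where cd: "c \<in> charts_at M (fst z)" "d \<in> charts_at N (snd z)"
    using prod_charts_exist[OF z] .
  note T = tangent_pair_tangent_space[OF v]
  show "proj1 M N z (tangent_pair M N z v1 v2) = v1" "proj2 M N z (tangent_pair M N z v1 v2) = v2"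
    using tangent_space_eqI[OF proj_tangent_space(1)[OF z T] v(1) cd(1)]
      tangent_space_eqI[OF proj_tangent_space(2)[OF z T] v(2) cd(2)]
    by (simp_all add: proj_apply[OF T cd] tangent_pair_apply[OF v cd])
qed

text \<open>Together with \<open>proj_tangent_pair\<close> this makes the tangent space at
  \<open>z\<close> the direct sum of the tangent spaces of the factors; equations on the product can
  be checked one component at a time.\<close>

lemma prod_tangent_eqI:
  assumes "v \<in> tangent_space (prod_mfd M N) z" "w \<in> tangent_space (prod_mfd M N) z"
    and "proj1 M N z v = proj1 M N z w" "proj2 M N z v = proj2 M N z w"
  shows "v = w"
proof -
  obtain c d where cd: "c \<in> charts_at M (fst z)" "d \<in> charts_at N (snd z)"
    using prod_charts_exist[OF z] .
  show ?thesis
    by (rule tangent_space_eqI[OF assms(1,2) prod_chart_charts_at[OF cd]])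
      (use assms(3,4) proj_apply[OF assms(1) cd] proj_apply[OF assms(2) cd] in
        \<open>simp add: prod_eq_iff\<close>)
qed

lemma proj_add:
  assumes v: "v \<in> tangent_space (prod_mfd M N) z" and w: "w \<in> tangent_space (prod_mfd M N) z"
  shows "proj1 M N z (v + w) = proj1 M N z v + proj1 M N z w"
    and "proj2 M N z (v + w) = proj2 M N z v + proj2 M N z w"
proof -
  obtain c d where cd: "c \<in> charts_at M (fst z)" "d \<in> charts_at N (snd z)"
    using prod_charts_exist[OF z] .
  note T = subspace_add[OF subspace_tangent_space[OF smooth_manifold_prod_mfd] v w]
  note P = proj_tangent_space[OF z]
  note S = subspace_add[OF subspace_tangent_space[OF M]] subspace_add[OF subspace_tangent_space[OF N]]
  show "proj1 M N z (v + w) = proj1 M N z v + proj1 M N z w"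
    by (rule tangent_space_eqI[OF P(1)[OF T] S(1)[OF P(1)[OF v] P(1)[OF w]] cd(1)])
      (simp add: proj_apply[OF T cd] proj_apply[OF v cd] proj_apply[OF w cd])
  show "proj2 M N z (v + w) = proj2 M N z v + proj2 M N z w"
    by (rule tangent_space_eqI[OF P(2)[OF T] S(2)[OF P(2)[OF v] P(2)[OF w]] cd(2)])
      (simp add: proj_apply[OF T cd] proj_apply[OF v cd] proj_apply[OF w cd])
qed

lemma proj_scaleR:
  assumes v: "v \<in> tangent_space (prod_mfd M N) z"
  shows "proj1 M N z (r *\<^sub>R v) = r *\<^sub>R proj1 M N z v"
    and "proj2 M N z (r *\<^sub>R v) = r *\<^sub>R proj2 M N z v"
proof -
  obtain c d where cd: "c \<in> charts_at M (fst z)" "d \<in> charts_at N (snd z)"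
    using prod_charts_exist[OF z] .
  note T = subspace_scale[OF subspace_tangent_space[OF smooth_manifold_prod_mfd] v, of r]
  note P = proj_tangent_space[OF z]
  note S = subspace_scale[OF subspace_tangent_space[OF M]] subspace_scale[OF subspace_tangent_space[OF N]]
  show "proj1 M N z (r *\<^sub>R v) = r *\<^sub>R proj1 M N z v"
    by (rule tangent_space_eqI[OF P(1)[OF T] S(1)[OF P(1)[OF v]] cd(1)])
      (simp add: proj_apply[OF T cd], simp add: proj_apply[OF v cd] scaleR_fun_def)
  show "proj2 M N z (r *\<^sub>R v) = r *\<^sub>R proj2 M N z v"
    by (rule tangent_space_eqI[OF P(2)[OF T] S(2)[OF P(2)[OF v]] cd(2)])
      (simp add: proj_apply[OF T cd], simp add: proj_apply[OF v cd] scaleR_fun_def)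
qed

text \<open>Smoothness is defined through coordinate fields; this reduces the conditions on the
  product to the components of the tensor fields on the factors.\<close>

lemma proj_coord_vec:
  assumes c: "c \<in> charts_at M (fst z)" and d: "d \<in> charts_at N (snd z)"
  shows "proj1 M N z (coord_vec (prod_mfd M N) (prod_chart c d) e z) = coord_vec M c (fst e) (fst z)"
    and "proj2 M N z (coord_vec (prod_mfd M N) (prod_chart c d) e z) = coord_vec N d (snd e) (snd z)"
proof -
  note C = prod_chart_charts_at[OF c d]
  note T = coord_vec_tangent_space[OF smooth_manifold_prod_mfd C, of e]
  note A = coord_vec_apply[OF smooth_manifold_prod_mfd C]
  show "proj1 M N z (coord_vec (prod_mfd M N) (prod_chart c d) e z) = coord_vec M c (fst e) (fst z)"
    by (rule tangent_space_eqI[OF proj_tangent_space(1)[OF z T] coord_vec_tangent_space[OF M c] c])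
      (simp add: proj_apply[OF T c d] A coord_vec_apply[OF M c])
  show "proj2 M N z (coord_vec (prod_mfd M N) (prod_chart c d) e z) = coord_vec N d (snd e) (snd z)"
    by (rule tangent_space_eqI[OF proj_tangent_space(2)[OF z T] coord_vec_tangent_space[OF N d] d])
      (simp add: proj_apply[OF T c d] A coord_vec_apply[OF N d])
qed

end

end

section \<open>Tensor fields in coordinates\<close>

lemma one_form_add:
  "one_form M \<omega> \<Longrightarrow> p \<in> points M \<Longrightarrow> v \<in> tangent_space M p \<Longrightarrow> w \<in> tangent_space M p \<Longrightarrow>
    \<omega> p (v + w) = \<omega> p v + \<omega> p w"
  unfolding one_form_def by blast

lemma one_form_scaleR:
  "one_form M \<omega> \<Longrightarrow> p \<in> points M \<Longrightarrow> v \<in> tangent_space M p \<Longrightarrow> \<omega> p (r *\<^sub>R v) = r * \<omega> p v"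
  unfolding one_form_def by blast

lemma one_form_smooth:
  "one_form M \<omega> \<Longrightarrow> c \<in> atlas M \<Longrightarrow>
    smooth_on (\<lambda>x. \<omega> (chart_inv c x) (coord_vec M c e (chart_inv c x))) (chart_image c)"
  unfolding one_form_def by blast

lemma endo_field_closed:
  "endo_field M A \<Longrightarrow> p \<in> points M \<Longrightarrow> v \<in> tangent_space M p \<Longrightarrow> A p v \<in> tangent_space M p"
  unfolding endo_field_def by blast

lemma endo_field_add:
  "endo_field M A \<Longrightarrow> p \<in> points M \<Longrightarrow> v \<in> tangent_space M p \<Longrightarrow> w \<in> tangent_space M p \<Longrightarrow>
    A p (v + w) = A p v + A p w"
  unfolding endo_field_def by blast

lemma endo_field_scaleR:
  "endo_field M A \<Longrightarrow> p \<in> points M \<Longrightarrow> v \<in> tangent_space M p \<Longrightarrow> A p (r *\<^sub>R v) = r *\<^sub>R A p v"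
  unfolding endo_field_def by blast

lemma endo_field_smooth:
  "endo_field M A \<Longrightarrow> c \<in> atlas M \<Longrightarrow>
    smooth_on (\<lambda>x. A (chart_inv c x) (coord_vec M c e (chart_inv c x)) c) (chart_image c)"
  unfolding endo_field_def by blast

lemma metric_add:
  "riemannian_metric M g \<Longrightarrow> p \<in> points M \<Longrightarrow>
    u \<in> tangent_space M p \<Longrightarrow> v \<in> tangent_space M p \<Longrightarrow> w \<in> tangent_space M p \<Longrightarrow>
    g p (u + v) w = g p u w + g p v w"
  by (rule riemannian_metric_def[THEN iffD1, THEN conjunct1, rule_format, THEN conjunct1])

lemma metric_scaleR:
  "riemannian_metric M g \<Longrightarrow> p \<in> points M \<Longrightarrow> u \<in> tangent_space M p \<Longrightarrow> w \<in> tangent_space M p \<Longrightarrow>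
    g p (r *\<^sub>R u) w = r * g p u w"
  by (rule riemannian_metric_def[THEN iffD1, THEN conjunct1, rule_format, THEN conjunct2, THEN conjunct1])

lemma metric_sym:
  "riemannian_metric M g \<Longrightarrow> p \<in> points M \<Longrightarrow> u \<in> tangent_space M p \<Longrightarrow> v \<in> tangent_space M p \<Longrightarrow>
    g p u v = g p v u"
  by (rule riemannian_metric_def[THEN iffD1, THEN conjunct1, rule_format, THEN conjunct2, THEN conjunct2])

lemma metric_pos:
  "riemannian_metric M g \<Longrightarrow> p \<in> points M \<Longrightarrow> v \<in> tangent_space M p \<Longrightarrow> v \<noteq> 0 \<Longrightarrow> g p v v > 0"
  unfolding riemannian_metric_def by blast

lemma metric_zero:
  assumes "smooth_manifold M" "riemannian_metric M g" "p \<in> points M" "w \<in> tangent_space M p"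
  shows "g p 0 w = 0"
  using metric_scaleR[OF assms(2,3) subspace_0[OF subspace_tangent_space[OF assms(1)]] assms(4), of 0]
  by simp

lemma metric_nonneg:
  assumes "smooth_manifold M" "riemannian_metric M g" "p \<in> points M" "v \<in> tangent_space M p"
  shows "g p v v \<ge> 0"
  using metric_zero[OF assms] metric_pos[OF assms(2-4)] by (cases "v = 0") auto

lemma metric_smooth:
  "riemannian_metric M g \<Longrightarrow> c \<in> atlas M \<Longrightarrow>
    smooth_on (\<lambda>x. g (chart_inv c x) (coord_vec M c e (chart_inv c x))
      (coord_vec M c e' (chart_inv c x))) (chart_image c)"
  by (rule riemannian_metric_def[THEN iffD1, THEN conjunct2, THEN conjunct2, rule_format])

lemma one_form_linear_coord:
  assumes "smooth_manifold M" "one_form M \<omega>" "c \<in> charts_at M p"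
  shows "linear (\<lambda>e. \<omega> p (coord_vec M c e p))"
  using one_form_add[OF assms(2) charts_at_imp_points[OF assms(1,3)]]
    one_form_scaleR[OF assms(2) charts_at_imp_points[OF assms(1,3)]]
    linear_add[OF linear_coord_vec[OF assms(1,3)]] linear_cmul[OF linear_coord_vec[OF assms(1,3)]]
    coord_vec_tangent_space[OF assms(1,3)]
  by (intro linearI) simp_all

lemma tangent_vector_coord:
  assumes "smooth_manifold M" "v \<in> tangent_space M p" "c \<in> charts_at M p"
  shows "v = coord_vec M c (v c) p"
  by (rule tangent_space_eqI[OF assms(2) coord_vec_tangent_space[OF assms(1,3)] assms(3)])
    (simp add: coord_vec_apply[OF assms(1,3)])

text \<open>The definition of \<open>one_form\<close> speaks only of coordinate fields with constant
  coefficients. For variable coefficients, expanding \<open>V x c\<close> in \<open>Basis\<close>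
  gives a finite sum of smooth coefficients times smooth components. The case of interest is
  \<open>V\<close> equal to \<open>J\<close> applied to a coordinate field.\<close>

lemma one_form_smooth_field:
  assumes M: "smooth_manifold M" and \<omega>: "one_form M \<omega>" and c: "c \<in> atlas M"
    and V: "\<And>x. x \<in> chart_image c \<Longrightarrow> V x \<in> tangent_space M (chart_inv c x)"
    and smooth: "smooth_on (\<lambda>x. V x c) (chart_image c)"
  shows "smooth_on (\<lambda>x. \<omega> (chart_inv c x) (V x)) (chart_image c)"
proof -
  note op = open_chart_image[OF M c]
  have "\<omega> (chart_inv c x) (V x) =
      (\<Sum>b\<in>Basis. (V x c \<bullet> b) * \<omega> (chart_inv c x) (coord_vec M c b (chart_inv c x)))"
    if x: "x \<in> chart_image c" for x
  proof -
    note C = charts_at_chart_inv[OF c x]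
    note L = one_form_linear_coord[OF M \<omega> C]
    have "\<omega> (chart_inv c x) (V x) = \<omega> (chart_inv c x) (coord_vec M c (V x c) (chart_inv c x))"
      using tangent_vector_coord[OF M V[OF x] C] by simp
    also have "\<dots> = \<omega> (chart_inv c x)
        (coord_vec M c (\<Sum>b\<in>Basis. (V x c \<bullet> b) *\<^sub>R b) (chart_inv c x))"
      by (simp add: euclidean_representation)
    finally show ?thesis
      by (simp add: linear_sum[OF L] linear_cmul[OF L])
  qed
  moreover have "smooth_on (\<lambda>x. \<Sum>b\<in>Basis.
      (V x c \<bullet> b) * \<omega> (chart_inv c x) (coord_vec M c b (chart_inv c x))) (chart_image c)"
    by (intro smooth_on_sum[OF op] smooth_on_mult[OF op] one_form_smooth[OF \<omega> c]
        smooth_on_compose_bounded_linear[OF bounded_linear_inner_left op smooth])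
  ultimately show ?thesis
    by (subst smooth_on_cong[OF op]) auto
qed

text \<open>A chart at some point identifies the tangent space with the model space
  \<open>'e\<close>, where \<open>J\<close> becomes a linear map with square minus the identity. A
  point is available because manifolds are nonempty by definition.\<close>

lemma even_dimension_of_almost_complex:
  fixes M :: "('a, 'e::euclidean_space) mfd"
  assumes M: "smooth_manifold M" and J: "endo_field M J"
    and JJ: "\<And>p v. p \<in> points M \<Longrightarrow> v \<in> tangent_space M p \<Longrightarrow> J p (J p v) = - v"
  shows "even DIM('e)"
proof -
  obtain p where p: "p \<in> points M" using M unfolding smooth_manifold_def by blast
  obtain c where c: "c \<in> charts_at M p" using charts_at_nonempty[OF M p] by blast
  note T = coord_vec_tangent_space[OF M c] and L = linear_coord_vec[OF M c]
  let ?j = "\<lambda>e. J p (coord_vec M c e p) c"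
  have "linear ?j"
    by (rule linearI)
      (simp_all add: linear_add[OF L] linear_cmul[OF L] endo_field_add[OF J p T T]
        endo_field_scaleR[OF J p T], simp add: scaleR_fun_def)
  moreover have "?j (?j e) = - e" for e
    \<comment> \<open>Reading off coordinates and forming the coordinate vector again returns the
      same tangent vector, so the inner \<open>?j\<close> passes its value unchanged to the outer
      \<open>J\<close>.\<close>
    using tangent_vector_coord[OF M endo_field_closed[OF J p T] c, symmetric] JJ[OF p T]
    by (simp add: coord_vec_apply[OF M c])
  ultimately show ?thesis by (rule even_dimension_of_complex_structure)
qed

section \<open>Almost contact metric manifolds\<close>

context
  fixes N :: "('b, 'f::euclidean_space) mfd" and \<phi> \<xi> \<eta> g
  assumes acm: "almost_contact_metric N \<phi> \<xi> \<eta> g"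
begin

lemma acm_manifold: "smooth_manifold N"
  and acm_odd: "odd DIM('f)"
  and acm_endo: "endo_field N \<phi>"
  and acm_vector_field: "vector_field N \<xi>"
  and acm_one_form: "one_form N \<eta>"
  and acm_metric: "riemannian_metric N g"
  using acm unfolding almost_contact_metric_def by auto

context
  fixes q assumes q: "q \<in> points N"
begin

lemma acm_phi_phi: "v \<in> tangent_space N q \<Longrightarrow> \<phi> q (\<phi> q v) = - v + \<eta> q v *\<^sub>R \<xi> q"
  and acm_eta_xi: "\<eta> q (\<xi> q) = 1"
  and acm_compatible: "v \<in> tangent_space N q \<Longrightarrow> w \<in> tangent_space N q \<Longrightarrow>
    g q (\<phi> q v) (\<phi> q w) = g q v w - \<eta> q v * \<eta> q w"
  and acm_xi: "\<xi> q \<in> tangent_space N q"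
  using acm q unfolding almost_contact_metric_def vector_field_def by blast+

lemma acm_linear_zero: "\<phi> q 0 = 0" "\<eta> q 0 = 0"
  using endo_field_scaleR[OF acm_endo q acm_xi, of 0] one_form_scaleR[OF acm_one_form q acm_xi, of 0]
  by simp_all

text \<open>From \<open>\<phi>\<^sup>2\<xi> = 0\<close> one gets \<open>0 = \<phi>\<^sup>3\<xi> = - \<phi>\<xi> + \<eta>(\<phi>\<xi>)\<xi>\<close>, so \<open>\<phi>\<xi> = k \<xi>\<close>, and then
  \<open>0 = \<phi>\<^sup>2\<xi> = k\<^sup>2 \<xi>\<close>.\<close>

lemma acm_phi_xi: "\<phi> q (\<xi> q) = 0"
proof -
  define k where "k = \<eta> q (\<phi> q (\<xi> q))"
  have 0: "\<phi> q (\<phi> q (\<xi> q)) = 0"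
    using acm_phi_phi[OF acm_xi] acm_eta_xi by simp
  then have k: "\<phi> q (\<xi> q) = k *\<^sub>R \<xi> q"
    using acm_phi_phi[OF endo_field_closed[OF acm_endo q acm_xi]]
    by (simp add: acm_linear_zero k_def)
  then have "k *\<^sub>R k *\<^sub>R \<xi> q = 0"
    using 0 endo_field_scaleR[OF acm_endo q acm_xi, of k] by simp
  moreover have "\<xi> q \<noteq> 0" using acm_eta_xi acm_linear_zero by auto
  ultimately show ?thesis using k by auto
qed

text \<open>The cube of \<open>\<phi>\<close> is computed in two ways: as \<open>\<phi>\<close>
  after its square it is \<open>- \<phi> v\<close>, by \<open>\<phi> \<xi> = 0\<close>, and as the
  square applied to \<open>\<phi> v\<close> it is
  \<open>- \<phi> v + \<eta>(\<phi> v) \<xi>\<close>. As \<open>\<xi>\<close> is nonzero, the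
  coefficient vanishes.\<close>

lemma acm_eta_phi:
  assumes v: "v \<in> tangent_space N q"
  shows "\<eta> q (\<phi> q v) = 0"
proof -
  note S = subspace_tangent_space[OF acm_manifold, of q]
  have "\<phi> q (\<phi> q (\<phi> q v)) = \<phi> q (- v + \<eta> q v *\<^sub>R \<xi> q)"
    using acm_phi_phi[OF v] by simp
  also have "\<dots> = - \<phi> q v"
    using endo_field_add[OF acm_endo q subspace_neg[OF S v] subspace_scale[OF S acm_xi]]
      endo_field_scaleR[OF acm_endo q v, of "-1"] endo_field_scaleR[OF acm_endo q acm_xi] acm_phi_xi
    by simp
  finally have "\<eta> q (\<phi> q v) *\<^sub>R \<xi> q = 0"
    using acm_phi_phi[OF endo_field_closed[OF acm_endo q v]] by simp
  moreover have "\<xi> q \<noteq> 0" using acm_eta_xi acm_linear_zero by auto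
  ultimately show ?thesis by simp
qed

lemma acm_eq_scaled_xi:
  assumes "v \<in> tangent_space N q" "\<phi> q v = 0"
  shows "v = \<eta> q v *\<^sub>R \<xi> q"
  using acm_phi_phi[OF assms(1)] assms(2) acm_linear_zero by simp

end

end

section \<open>The almost contact metric structure on the product\<close>

locale hermitian_contact_product =
  fixes M :: "('a, 'e::euclidean_space) mfd" and N :: "('b, 'f::euclidean_space) mfd"
    and J :: "'a \<Rightarrow> ('a, 'e) tangent \<Rightarrow> ('a, 'e) tangent"
    and g1 :: "'a \<Rightarrow> ('a, 'e) tangent \<Rightarrow> ('a, 'e) tangent \<Rightarrow> real"
    and \<omega> :: "'a \<Rightarrow> ('a, 'e) tangent \<Rightarrow> real"
    and \<phi> :: "'b \<Rightarrow> ('b, 'f) tangent \<Rightarrow> ('b, 'f) tangent"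
    and \<xi> :: "'b \<Rightarrow> ('b, 'f) tangent"
    and \<eta> :: "'b \<Rightarrow> ('b, 'f) tangent \<Rightarrow> real"
    and g2 :: "'b \<Rightarrow> ('b, 'f) tangent \<Rightarrow> ('b, 'f) tangent \<Rightarrow> real"
    and a :: real
    and f :: "'a \<Rightarrow> real"
  assumes hermitian: "almost_hermitian M J g1"
    and omega_form: "one_form M \<omega>"
    and acm: "almost_contact_metric N \<phi> \<xi> \<eta> g2"
    and f_smooth: "smooth_function M f"
    and f_pos: "\<And>p. p \<in> points M \<Longrightarrow> f p > 0"
begin

lemma M_mfd: "smooth_manifold M" and J_endo: "endo_field M J" and g1_metric: "riemannian_metric M g1"
  and J_J: "p \<in> points M \<Longrightarrow> v \<in> tangent_space M p \<Longrightarrow> J p (J p v) = - v"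
  and g1_J: "p \<in> points M \<Longrightarrow> v \<in> tangent_space M p \<Longrightarrow> w \<in> tangent_space M p \<Longrightarrow>
    g1 p (J p v) (J p w) = g1 p v w"
  using hermitian unfolding almost_hermitian_def by blast+

lemmas N_mfd = acm_manifold[OF acm]
  and phi_endo = acm_endo[OF acm]
  and eta_form = acm_one_form[OF acm]
  and g2_metric = acm_metric[OF acm]
  and P_mfd = smooth_manifold_prod_mfd[OF M_mfd acm_manifold[OF acm]]

abbreviation "\<phi>' \<equiv> phi_bar M N a \<omega> J \<phi> \<xi>"
abbreviation "\<xi>' \<equiv> xi_bar M N \<xi>"
abbreviation "\<eta>' \<equiv> eta_bar M N a \<omega> \<eta>"
abbreviation "g' \<equiv> g_bar M N a f \<omega> \<eta> g1 g2"

section \<open>Tensor identities at a fixed point of the product\<close>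

context
  fixes z assumes z: "z \<in> points (prod_mfd M N)"
begin

lemma fst_point: "fst z \<in> points M" and snd_point: "snd z \<in> points N"
  using z by (simp_all add: points_prod_mfd mem_Times_iff)

lemmas proj1_tangent = proj_tangent_space(1)[OF M_mfd N_mfd z]
  and proj2_tangent = proj_tangent_space(2)[OF M_mfd N_mfd z]
  and J_tangent = endo_field_closed[OF J_endo fst_point]
  and phi_tangent = endo_field_closed[OF phi_endo snd_point]
  and xi_tangent = acm_xi[OF acm snd_point]
  and M_subspace = subspace_tangent_space[OF M_mfd, of "fst z"]
  and N_subspace = subspace_tangent_space[OF N_mfd, of "snd z"]
  and P_subspace = subspace_tangent_space[OF P_mfd, of z]

lemma xi_bar_tangent: "\<xi>' z \<in> tangent_space (prod_mfd M N) z"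
  unfolding xi_bar_def
  by (intro tangent_pair_tangent_space[OF M_mfd N_mfd] subspace_0[OF M_subspace] xi_tangent)

lemma proj_xi_bar: "proj1 M N z (\<xi>' z) = 0" "proj2 M N z (\<xi>' z) = \<xi> (snd z)"
  unfolding xi_bar_def
  by (simp_all add: proj_tangent_pair[OF M_mfd N_mfd z subspace_0[OF M_subspace] xi_tangent])

lemma phi_bar_components:
  assumes v: "v \<in> tangent_space (prod_mfd M N) z"
  shows "J (fst z) (proj1 M N z v) \<in> tangent_space M (fst z)"
    and "\<phi> (snd z) (proj2 M N z v) - (a * \<omega> (fst z) (J (fst z) (proj1 M N z v))) *\<^sub>R \<xi> (snd z)
      \<in> tangent_space N (snd z)"
  by (intro J_tangent proj1_tangent v)
    (intro subspace_diff[OF N_subspace] phi_tangent proj2_tangent v subspace_scale[OF N_subspace]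
      xi_tangent)

lemma phi_bar_tangent:
  "v \<in> tangent_space (prod_mfd M N) z \<Longrightarrow> \<phi>' z v \<in> tangent_space (prod_mfd M N) z"
  unfolding phi_bar_def Let_def by (intro tangent_pair_tangent_space[OF M_mfd N_mfd] phi_bar_components)

lemma proj_phi_bar:
  assumes v: "v \<in> tangent_space (prod_mfd M N) z"
  shows "proj1 M N z (\<phi>' z v) = J (fst z) (proj1 M N z v)"
    and "proj2 M N z (\<phi>' z v) =
      \<phi> (snd z) (proj2 M N z v) - (a * \<omega> (fst z) (J (fst z) (proj1 M N z v))) *\<^sub>R \<xi> (snd z)"
  unfolding phi_bar_def Let_def
  by (simp_all add: proj_tangent_pair[OF M_mfd N_mfd z phi_bar_components[OF v]])

text \<open>Because \<open>\<phi> \<xi> = 0\<close>, the correction term inside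
  \<open>phi_bar\<close> disappears as soon as \<open>\<phi>\<close> is applied again.\<close>

lemma phi_minus_xi:
  assumes "u \<in> tangent_space N (snd z)"
  shows "\<phi> (snd z) (u - r *\<^sub>R \<xi> (snd z)) = \<phi> (snd z) u"
  using endo_field_add[OF phi_endo snd_point assms subspace_scale[OF N_subspace xi_tangent], of "- r"]
    endo_field_scaleR[OF phi_endo snd_point xi_tangent, of "- r"] acm_phi_xi[OF acm snd_point]
  by simp

lemma eta_minus_xi:
  assumes "u \<in> tangent_space N (snd z)"
  shows "\<eta> (snd z) (u - r *\<^sub>R \<xi> (snd z)) = \<eta> (snd z) u - r"
  using one_form_add[OF eta_form snd_point assms subspace_scale[OF N_subspace xi_tangent], of "- r"]
    one_form_scaleR[OF eta_form snd_point xi_tangent, of "- r"] acm_eta_xi[OF acm snd_point]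
  by simp

lemma omega_minus: "u \<in> tangent_space M (fst z) \<Longrightarrow> \<omega> (fst z) (- u) = - \<omega> (fst z) u"
  using one_form_scaleR[OF omega_form fst_point, of u "-1"] by simp

lemma omega_zero: "\<omega> (fst z) 0 = 0"
  using one_form_scaleR[OF omega_form fst_point subspace_0[OF M_subspace], of 0] by simp

lemma eta_bar_add:
  assumes "v \<in> tangent_space (prod_mfd M N) z" "w \<in> tangent_space (prod_mfd M N) z"
  shows "\<eta>' z (v + w) = \<eta>' z v + \<eta>' z w"
  unfolding eta_bar_def
  by (simp add: proj_add[OF M_mfd N_mfd z assms] one_form_add[OF omega_form fst_point] one_form_add[OF eta_form snd_point]
      proj1_tangent proj2_tangent assms algebra_simps)

lemma eta_bar_scaleR:
  assumes "v \<in> tangent_space (prod_mfd M N) z"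
  shows "\<eta>' z (r *\<^sub>R v) = r * \<eta>' z v"
  unfolding eta_bar_def
  by (simp add: proj_scaleR[OF M_mfd N_mfd z assms] one_form_scaleR[OF omega_form fst_point]
      one_form_scaleR[OF eta_form snd_point] proj1_tangent proj2_tangent assms algebra_simps)

lemma eta_bar_xi_bar: "\<eta>' z (\<xi>' z) = 1"
  by (simp add: eta_bar_def proj_xi_bar omega_zero acm_eta_xi[OF acm snd_point])

text \<open>Since \<open>\<eta>\<close> vanishes on the image of \<open>\<phi>\<close>, the second
  component contributes only the correction \<open>- a \<omega>(J v1)\<close>, which cancels the
  contribution of the first.\<close>

lemma eta_bar_phi_bar:
  assumes v: "v \<in> tangent_space (prod_mfd M N) z"
  shows "\<eta>' z (\<phi>' z v) = 0"
  by (simp add: eta_bar_def proj_phi_bar[OF v] eta_minus_xi phi_tangent proj2_tangent v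
      acm_eta_phi[OF acm snd_point])

lemma phi_bar_add:
  assumes v: "v \<in> tangent_space (prod_mfd M N) z" and w: "w \<in> tangent_space (prod_mfd M N) z"
  shows "\<phi>' z (v + w) = \<phi>' z v + \<phi>' z w"
proof -
  note vw = subspace_add[OF P_subspace v w]
  note add = proj_add[OF M_mfd N_mfd z] endo_field_add[OF J_endo fst_point] endo_field_add[OF phi_endo snd_point]
    one_form_add[OF omega_form fst_point]
  show ?thesis
    by (rule prod_tangent_eqI[OF M_mfd N_mfd z phi_bar_tangent[OF vw]
          subspace_add[OF P_subspace phi_bar_tangent[OF v] phi_bar_tangent[OF w]]])
      (simp_all add: add phi_bar_tangent v w vw proj_phi_bar proj1_tangent proj2_tangent J_tangent
        scaleR_add_left distrib_left)
qed

lemma phi_bar_scaleR: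
  assumes v: "v \<in> tangent_space (prod_mfd M N) z"
  shows "\<phi>' z (r *\<^sub>R v) = r *\<^sub>R \<phi>' z v"
proof -
  note rv = subspace_scale[OF P_subspace v, of r]
  note scale = proj_scaleR[OF M_mfd N_mfd z] endo_field_scaleR[OF J_endo fst_point]
    endo_field_scaleR[OF phi_endo snd_point] one_form_scaleR[OF omega_form fst_point]
  show ?thesis
    by (rule prod_tangent_eqI[OF M_mfd N_mfd z phi_bar_tangent[OF rv]
          subspace_scale[OF P_subspace phi_bar_tangent[OF v]]])
      (simp_all add: scale phi_bar_tangent v rv proj_phi_bar proj1_tangent proj2_tangent J_tangent
        scaleR_right_diff_distrib mult.left_commute)
qed

text \<open>In the first component \<open>J\<close> squares to minus the identity and
  \<open>xi_bar\<close> is zero. In the second, \<open>\<phi>\<close> removes the inner correction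
  and leaves \<open>- v2 + \<eta>(v2) \<xi>\<close>, while the outer correction is
  \<open>a \<omega>(v1) \<xi>\<close> because \<open>J (J v1) = - v1\<close>. The two multiples of
  \<open>\<xi>\<close> add up to \<open>eta_bar(v) \<xi>\<close>.\<close>

lemma phi_bar_phi_bar:
  assumes v: "v \<in> tangent_space (prod_mfd M N) z"
  shows "\<phi>' z (\<phi>' z v) = - v + \<eta>' z v *\<^sub>R \<xi>' z"
proof -
  note w = phi_bar_tangent[OF v]
  note nv = subspace_neg[OF P_subspace v] and s = subspace_scale[OF P_subspace xi_bar_tangent]
  have minus: "proj1 M N z (- v) = - proj1 M N z v" "proj2 M N z (- v) = - proj2 M N z v"
    using proj_scaleR[OF M_mfd N_mfd z v, of "-1"] by simp_all
  show ?thesis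
  proof (rule prod_tangent_eqI[OF M_mfd N_mfd z phi_bar_tangent[OF w] subspace_add[OF P_subspace nv s]])
    show "proj1 M N z (\<phi>' z (\<phi>' z v)) = proj1 M N z (- v + \<eta>' z v *\<^sub>R \<xi>' z)"
      unfolding proj_add[OF M_mfd N_mfd z nv s] proj_scaleR[OF M_mfd N_mfd z xi_bar_tangent] proj_xi_bar minus
      by (simp add: proj_phi_bar w v J_J[OF fst_point] proj1_tangent)
    show "proj2 M N z (\<phi>' z (\<phi>' z v)) = proj2 M N z (- v + \<eta>' z v *\<^sub>R \<xi>' z)"
      unfolding proj_add[OF M_mfd N_mfd z nv s] proj_scaleR[OF M_mfd N_mfd z xi_bar_tangent] proj_xi_bar minus
      by (simp add: proj_phi_bar w v J_J[OF fst_point] proj1_tangent phi_minus_xi phi_tangent proj2_tangent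
          acm_phi_phi[OF acm snd_point] omega_minus eta_bar_def scaleR_add_left)
  qed
qed

text \<open>Compatibility of \<open>g2\<close> turns the degenerate middle form into the pullback of
  \<open>g2\<close> under \<open>\<phi>\<close>, which is visibly positive semidefinite and blind to
  multiples of \<open>\<xi>\<close>.\<close>

lemma g_bar_eq:
  assumes "v \<in> tangent_space (prod_mfd M N) z" "w \<in> tangent_space (prod_mfd M N) z"
  shows "g' z v w = g1 (fst z) (proj1 M N z v) (proj1 M N z w) +
    (f (fst z))\<^sup>2 * g2 (snd z) (\<phi> (snd z) (proj2 M N z v)) (\<phi> (snd z) (proj2 M N z w)) +
    \<eta>' z v * \<eta>' z w"
  by (simp add: g_bar_def Let_def acm_compatible[OF acm snd_point] proj2_tangent assms)

text \<open>\<open>J\<close> preserves the first summand and \<open>eta_bar\<close> vanishes on the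
  image of \<open>phi_bar\<close>. In the middle summand compatibility is instantiated at
  \<open>\<phi> _\<close>, so that it lowers only the terms with two applications of
  \<open>\<phi>\<close>; both sides then meet in \<open>g2 (\<phi> v2) (\<phi> w2)\<close>.\<close>

lemma g_bar_phi_bar:
  assumes v: "v \<in> tangent_space (prod_mfd M N) z" and w: "w \<in> tangent_space (prod_mfd M N) z"
  shows "g' z (\<phi>' z v) (\<phi>' z w) = g' z v w - \<eta>' z v * \<eta>' z w"
  by (simp add: g_bar_eq phi_bar_tangent v w eta_bar_phi_bar proj_phi_bar g1_J[OF fst_point]
      proj1_tangent proj2_tangent phi_tangent phi_minus_xi acm_compatible[OF acm snd_point, of "\<phi> (snd z) _"]
      acm_eta_phi[OF acm snd_point])

lemma g_bar_add:
  assumes "u \<in> tangent_space (prod_mfd M N) z" "v \<in> tangent_space (prod_mfd M N) z"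
    "w \<in> tangent_space (prod_mfd M N) z"
  shows "g' z (u + v) w = g' z u w + g' z v w"
  by (simp add: g_bar_eq subspace_add[OF P_subspace] assms eta_bar_add proj_add[OF M_mfd N_mfd z]
      metric_add[OF g1_metric fst_point] metric_add[OF g2_metric snd_point] endo_field_add[OF phi_endo snd_point]
      proj1_tangent proj2_tangent phi_tangent algebra_simps)

lemma g_bar_scaleR:
  assumes "u \<in> tangent_space (prod_mfd M N) z" "w \<in> tangent_space (prod_mfd M N) z"
  shows "g' z (r *\<^sub>R u) w = r * g' z u w"
  by (simp add: g_bar_eq subspace_scale[OF P_subspace] assms eta_bar_scaleR proj_scaleR[OF M_mfd N_mfd z]
      metric_scaleR[OF g1_metric fst_point] metric_scaleR[OF g2_metric snd_point]
      endo_field_scaleR[OF phi_endo snd_point] proj1_tangent proj2_tangent phi_tangent algebra_simps)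

lemma g_bar_sym:
  assumes "u \<in> tangent_space (prod_mfd M N) z" "w \<in> tangent_space (prod_mfd M N) z"
  shows "g' z u w = g' z w u"
  using metric_sym[OF g1_metric fst_point proj1_tangent[OF assms(1)] proj1_tangent[OF assms(2)]]
    metric_sym[OF g2_metric snd_point proj2_tangent[OF assms(1)] proj2_tangent[OF assms(2)]]
  by (simp add: g_bar_def Let_def mult.commute)

lemma g_bar_pos:
  assumes v: "v \<in> tangent_space (prod_mfd M N) z" and "v \<noteq> 0"
  shows "g' z v v > 0"
proof -
  let ?v1 = "proj1 M N z v" and ?v2 = "proj2 M N z v"
  let ?w = "\<phi> (snd z) ?v2"
  note T = proj1_tangent[OF v] proj2_tangent[OF v] phi_tangent[OF proj2_tangent[OF v]]
  have f: "(f (fst z))\<^sup>2 > 0" using f_pos[OF fst_point] by simp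
  have nonneg: "g1 (fst z) ?v1 ?v1 \<ge> 0" "(f (fst z))\<^sup>2 * g2 (snd z) ?w ?w \<ge> 0" "\<eta>' z v * \<eta>' z v \<ge> 0"
    using metric_nonneg[OF M_mfd g1_metric fst_point T(1)] metric_nonneg[OF N_mfd g2_metric snd_point T(3)] by auto
  have g: "g' z v v = g1 (fst z) ?v1 ?v1 + (f (fst z))\<^sup>2 * g2 (snd z) ?w ?w + \<eta>' z v * \<eta>' z v"
    by (rule g_bar_eq[OF v v])
  \<comment> \<open>Each case makes one of the three nonnegative summands strictly positive.\<close>
  consider "?v1 \<noteq> 0" | "?w \<noteq> 0" | "?v1 = 0" "?w = 0" by blast
  then show ?thesis
  proof cases
    case 1
    then show ?thesis using g nonneg metric_pos[OF g1_metric fst_point T(1)] by linarith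
  next
    case 2
    then have "(f (fst z))\<^sup>2 * g2 (snd z) ?w ?w > 0"
      using f metric_pos[OF g2_metric snd_point T(3)] by simp
    then show ?thesis using g nonneg by linarith
  next
    case 3
    have v2: "?v2 = \<eta> (snd z) ?v2 *\<^sub>R \<xi> (snd z)"
      by (rule acm_eq_scaled_xi[OF acm snd_point T(2) 3(2)])
    \<comment> \<open>With \<open>?v1 = 0\<close> this coefficient is the value of
      \<open>eta_bar\<close> at \<open>v\<close>, and \<open>v\<close> itself is that multiple of
      \<open>xi_bar\<close>.\<close>
    have "\<eta> (snd z) ?v2 \<noteq> 0"
    proof
      assume "\<eta> (snd z) ?v2 = 0"
      then have "?v2 = 0" using v2 by simp
      moreover have "proj1 M N z 0 = 0" "proj2 M N z 0 = 0"
        using proj_scaleR[OF M_mfd N_mfd z v, of 0] by simp_all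
      ultimately have "v = 0"
        using 3(1) by (intro prod_tangent_eqI[OF M_mfd N_mfd z v subspace_0[OF P_subspace]]) simp_all
      then show False using \<open>v \<noteq> 0\<close> by simp
    qed
    then have "\<eta>' z v * \<eta>' z v > 0"
      by (auto simp: eta_bar_def 3(1) omega_zero zero_less_mult_iff)
    then show ?thesis using g nonneg by linarith
  qed
qed

end

section \<open>Smoothness of the structure in product charts\<close>

context
  fixes c d assumes c: "c \<in> atlas M" and d: "d \<in> atlas N"
begin

lemmas op = open_chart_image[OF M_mfd c] open_chart_image[OF N_mfd d]
  and opP = open_Times[OF open_chart_image[OF M_mfd c] open_chart_image[OF N_mfd d]]

context
  fixes x assumes x: "x \<in> chart_image c \<times> chart_image d"
begin

lemma chart_inv_charts_at:
  "c \<in> charts_at M (chart_inv c (fst x))" "d \<in> charts_at N (chart_inv d (snd x))"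
  using x by (auto intro: charts_at_chart_inv c d)

lemma chart_inv_point: "(chart_inv c (fst x), chart_inv d (snd x)) \<in> points (prod_mfd M N)"
  using charts_at_imp_points[OF M_mfd chart_inv_charts_at(1)]
    charts_at_imp_points[OF N_mfd chart_inv_charts_at(2)] by (simp add: points_prod_mfd)

lemma chart_inv_prod_charts_at:
  "prod_chart c d \<in> charts_at (prod_mfd M N) (chart_inv c (fst x), chart_inv d (snd x))"
  by (intro prod_chart_charts_at) (simp_all add: chart_inv_charts_at)

lemma coord_vec_prod_tangent:
  "coord_vec (prod_mfd M N) (prod_chart c d) e (chart_inv c (fst x), chart_inv d (snd x))
    \<in> tangent_space (prod_mfd M N) (chart_inv c (fst x), chart_inv d (snd x))"
  by (rule coord_vec_tangent_space[OF P_mfd chart_inv_prod_charts_at])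

lemma proj_coord_vec_chart_inv:
  "proj1 M N (chart_inv c (fst x), chart_inv d (snd x)) (coord_vec (prod_mfd M N) (prod_chart c d) e
    (chart_inv c (fst x), chart_inv d (snd x))) = coord_vec M c (fst e) (chart_inv c (fst x))"
  "proj2 M N (chart_inv c (fst x), chart_inv d (snd x)) (coord_vec (prod_mfd M N) (prod_chart c d) e
    (chart_inv c (fst x), chart_inv d (snd x))) = coord_vec N d (snd e) (chart_inv d (snd x))"
  using proj_coord_vec[OF M_mfd N_mfd chart_inv_point, of c d e] chart_inv_charts_at by simp_all

end

lemma xi_bar_smooth:
  "smooth_on (\<lambda>x. \<xi>' (chart_inv (prod_chart c d) x) (prod_chart c d)) (chart_image (prod_chart c d))"
proof -
  have "smooth_on (\<lambda>y. \<xi> (chart_inv d y) d) (chart_image d)"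
    using acm_vector_field[OF acm] d unfolding vector_field_def by blast
  then have "smooth_on (\<lambda>x. (0::'e, \<xi> (chart_inv d (snd x)) d)) (chart_image c \<times> chart_image d)"
    by (intro smooth_on_Pair[OF opP] smooth_on_const smooth_on_snd[OF _ op(2,1)])
  moreover have "\<xi>' (chart_inv (prod_chart c d) x) (prod_chart c d) = (0, \<xi> (chart_inv d (snd x)) d)"
    if x: "x \<in> chart_image c \<times> chart_image d" for x
    using tangent_pair_apply[OF M_mfd N_mfd, of 0 "(chart_inv c (fst x), chart_inv d (snd x))"
        "\<xi> (chart_inv d (snd x))" c d] chart_inv_charts_at[OF x]
      subspace_0[OF subspace_tangent_space[OF M_mfd]]
      acm_xi[OF acm charts_at_imp_points[OF N_mfd chart_inv_charts_at(2)[OF x]]]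
    by (simp add: chart_inv_prod_chart[OF M_mfd N_mfd c d x] xi_bar_def)
  ultimately show ?thesis
    unfolding chart_image_prod_chart by (subst smooth_on_cong[OF opP])
qed

lemma eta_bar_smooth:
  "smooth_on (\<lambda>x. \<eta>' (chart_inv (prod_chart c d) x)
    (coord_vec (prod_mfd M N) (prod_chart c d) e (chart_inv (prod_chart c d) x)))
    (chart_image (prod_chart c d))"
proof -
  have "smooth_on (\<lambda>x. a * \<omega> (chart_inv c (fst x)) (coord_vec M c (fst e) (chart_inv c (fst x))) +
      \<eta> (chart_inv d (snd x)) (coord_vec N d (snd e) (chart_inv d (snd x))))
      (chart_image c \<times> chart_image d)"
    using one_form_smooth[OF omega_form c] one_form_smooth[OF eta_form d]
    by (intro smooth_on_add[OF opP] smooth_on_mult[OF opP] smooth_on_const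
        smooth_on_fst[where A = "chart_image c", OF _ op] smooth_on_snd[where A = "chart_image d", OF _ op(2,1)])
  then show ?thesis
    unfolding chart_image_prod_chart
    by (subst smooth_on_cong[OF opP])
      (simp_all add: chart_inv_prod_chart[OF M_mfd N_mfd c d] eta_bar_def proj_coord_vec_chart_inv)
qed

lemma g_bar_smooth:
  "smooth_on (\<lambda>x. g' (chart_inv (prod_chart c d) x)
    (coord_vec (prod_mfd M N) (prod_chart c d) e (chart_inv (prod_chart c d) x))
    (coord_vec (prod_mfd M N) (prod_chart c d) e' (chart_inv (prod_chart c d) x)))
    (chart_image (prod_chart c d))"
proof -
  note fst_sm = smooth_on_fst[where A = "chart_image c", OF _ op]
    and snd_sm = smooth_on_snd[where A = "chart_image d", OF _ op(2,1)]
  have f: "smooth_on (\<lambda>x. f (chart_inv c x)) (chart_image c)"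
    using f_smooth c unfolding smooth_function_def o_def by blast
  \<comment> \<open>The square of \<open>f\<close> is written as a product for the product rule, and
    the \<open>eta_bar\<close> factors stay folded so that \<open>eta_bar_smooth\<close> supplies
    them.\<close>
  have "smooth_on (\<lambda>x. g1 (chart_inv c (fst x)) (coord_vec M c (fst e) (chart_inv c (fst x)))
        (coord_vec M c (fst e') (chart_inv c (fst x))) +
      f (chart_inv c (fst x)) * f (chart_inv c (fst x)) *
        (g2 (chart_inv d (snd x)) (coord_vec N d (snd e) (chart_inv d (snd x)))
          (coord_vec N d (snd e') (chart_inv d (snd x))) -
        \<eta> (chart_inv d (snd x)) (coord_vec N d (snd e) (chart_inv d (snd x))) *
        \<eta> (chart_inv d (snd x)) (coord_vec N d (snd e') (chart_inv d (snd x)))) +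
      \<eta>' (chart_inv (prod_chart c d) x)
        (coord_vec (prod_mfd M N) (prod_chart c d) e (chart_inv (prod_chart c d) x)) *
      \<eta>' (chart_inv (prod_chart c d) x)
        (coord_vec (prod_mfd M N) (prod_chart c d) e' (chart_inv (prod_chart c d) x)))
      (chart_image c \<times> chart_image d)"
    using eta_bar_smooth[unfolded chart_image_prod_chart]
    by (intro smooth_on_add[OF opP] smooth_on_mult[OF opP] smooth_on_diff[OF opP]
        fst_sm[OF metric_smooth[OF g1_metric c]] snd_sm[OF metric_smooth[OF g2_metric d]]
        snd_sm[OF one_form_smooth[OF eta_form d]] fst_sm[OF f])
  then show ?thesis
    unfolding chart_image_prod_chart
    by (subst smooth_on_cong[OF opP])
      (simp_all add: chart_inv_prod_chart[OF M_mfd N_mfd c d] g_bar_def Let_def proj_coord_vec_chart_inv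
        power2_eq_square)
qed

lemma phi_bar_smooth:
  "smooth_on (\<lambda>x. \<phi>' (chart_inv (prod_chart c d) x)
    (coord_vec (prod_mfd M N) (prod_chart c d) e (chart_inv (prod_chart c d) x)) (prod_chart c d))
    (chart_image (prod_chart c d))"
proof -
  note fst_sm = smooth_on_fst[where A = "chart_image c", OF _ op]
    and snd_sm = smooth_on_snd[where A = "chart_image d", OF _ op(2,1)]
  \<comment> \<open>The image of a coordinate field under \<open>J\<close> has variable
    coefficients; tangency is the premise that \<open>one_form_smooth_field\<close> needs for
    it.\<close>
  have "J (chart_inv c x) (coord_vec M c (fst e) (chart_inv c x)) \<in> tangent_space M (chart_inv c x)"
    if "x \<in> chart_image c" for x
    using charts_at_chart_inv[OF c that]
    by (intro endo_field_closed[OF J_endo] coord_vec_tangent_space[OF M_mfd] charts_at_imp_points[OF M_mfd])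
  then have omega_J: "smooth_on (\<lambda>x. \<omega> (chart_inv c x)
      (J (chart_inv c x) (coord_vec M c (fst e) (chart_inv c x)))) (chart_image c)"
    by (intro one_form_smooth_field[OF M_mfd omega_form c] endo_field_smooth[OF J_endo c])
  have xi: "smooth_on (\<lambda>y. \<xi> (chart_inv d y) d) (chart_image d)"
    using acm_vector_field[OF acm] d unfolding vector_field_def by blast
  have "smooth_on (\<lambda>x. (J (chart_inv c (fst x)) (coord_vec M c (fst e) (chart_inv c (fst x))) c,
      \<phi> (chart_inv d (snd x)) (coord_vec N d (snd e) (chart_inv d (snd x))) d -
      (a * \<omega> (chart_inv c (fst x)) (J (chart_inv c (fst x))
        (coord_vec M c (fst e) (chart_inv c (fst x))))) *\<^sub>R \<xi> (chart_inv d (snd x)) d))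
      (chart_image c \<times> chart_image d)"
    by (intro smooth_on_Pair[OF opP] smooth_on_diff[OF opP] smooth_on_scaleR[OF opP]
        smooth_on_mult[OF opP] smooth_on_const fst_sm[OF endo_field_smooth[OF J_endo c]]
        snd_sm[OF endo_field_smooth[OF phi_endo d]] fst_sm[OF omega_J] snd_sm[OF xi])
  moreover have "\<phi>' (chart_inv (prod_chart c d) x)
      (coord_vec (prod_mfd M N) (prod_chart c d) e (chart_inv (prod_chart c d) x)) (prod_chart c d) =
      (J (chart_inv c (fst x)) (coord_vec M c (fst e) (chart_inv c (fst x))) c,
      \<phi> (chart_inv d (snd x)) (coord_vec N d (snd e) (chart_inv d (snd x))) d -
      (a * \<omega> (chart_inv c (fst x)) (J (chart_inv c (fst x))
        (coord_vec M c (fst e) (chart_inv c (fst x))))) *\<^sub>R \<xi> (chart_inv d (snd x)) d)"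
    if x: "x \<in> chart_image c \<times> chart_image d" for x
    using tangent_pair_apply[OF M_mfd N_mfd phi_bar_components[OF chart_inv_point[OF x]
          coord_vec_prod_tangent[OF x]], of c d e] chart_inv_charts_at[OF x]
    by (simp add: chart_inv_prod_chart[OF M_mfd N_mfd c d x] phi_bar_def Let_def
        proj_coord_vec_chart_inv[OF x] scaleR_fun_def)
  ultimately show ?thesis
    unfolding chart_image_prod_chart by (subst smooth_on_cong[OF opP])
qed

end

lemma almost_contact_metric_prod: "almost_contact_metric (prod_mfd M N) \<phi>' \<xi>' \<eta>' g'"
proof -
  \<comment> \<open>The dimension is the sum of an even one, by the complex structure on the first
    factor, and an odd one.\<close>
  have "odd DIM('e \<times> 'f)"
    using even_dimension_of_almost_complex[OF M_mfd J_endo J_J] acm_odd[OF acm] by simp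
  moreover have "endo_field (prod_mfd M N) \<phi>'"
    unfolding endo_field_def ball_atlas_prod_mfd
    by (intro conjI ballI allI phi_bar_tangent phi_bar_add phi_bar_scaleR phi_bar_smooth)
  moreover have "vector_field (prod_mfd M N) \<xi>'"
    unfolding vector_field_def ball_atlas_prod_mfd
    by (intro conjI ballI xi_bar_tangent xi_bar_smooth)
  moreover have "one_form (prod_mfd M N) \<eta>'"
    unfolding one_form_def ball_atlas_prod_mfd
    by (intro conjI ballI allI eta_bar_add eta_bar_scaleR eta_bar_smooth)
  moreover have "riemannian_metric (prod_mfd M N) g'"
    unfolding riemannian_metric_def ball_atlas_prod_mfd
    by (intro conjI ballI allI impI g_bar_add g_bar_scaleR g_bar_sym g_bar_pos g_bar_smooth)
  ultimately show ?thesis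
    unfolding almost_contact_metric_def
    using P_mfd phi_bar_phi_bar eta_bar_xi_bar g_bar_phi_bar by blast
qed

end

theorem theorem4p1:
  fixes M1 :: "('a, 'e::euclidean_space) mfd"
    and M2 :: "('b, 'f::euclidean_space) mfd"
    and J :: "'a \<Rightarrow> ('a, 'e) tangent \<Rightarrow> ('a, 'e) tangent"
    and g1 :: "'a \<Rightarrow> ('a, 'e) tangent \<Rightarrow> ('a, 'e) tangent \<Rightarrow> real"
    and \<omega> :: "'a \<Rightarrow> ('a, 'e) tangent \<Rightarrow> real"
    and \<phi> :: "'b \<Rightarrow> ('b, 'f) tangent \<Rightarrow> ('b, 'f) tangent"
    and \<xi> :: "'b \<Rightarrow> ('b, 'f) tangent"
    and \<eta> :: "'b \<Rightarrow> ('b, 'f) tangent \<Rightarrow> real"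
    and g2 :: "'b \<Rightarrow> ('b, 'f) tangent \<Rightarrow> ('b, 'f) tangent \<Rightarrow> real"
    and a :: real
    and f :: "'a \<Rightarrow> real"
  assumes "almost_hermitian M1 J g1"
    and "one_form M1 \<omega>"
    and "\<And>V W p. vector_field M1 V \<Longrightarrow> vector_field M1 W \<Longrightarrow> p \<in> points M1 \<Longrightarrow>
           ext_deriv M1 \<omega> V W p = fundamental_form J g1 p (V p) (W p)"
    and "almost_contact_metric M2 \<phi> \<xi> \<eta> g2"
    and "smooth_function M1 f"
    and "\<And>p. p \<in> points M1 \<Longrightarrow> f p > 0"
  shows "almost_contact_metric (prod_mfd M1 M2)
           (phi_bar M1 M2 a \<omega> J \<phi> \<xi>) (xi_bar M1 M2 \<xi>) (eta_bar M1 M2 a \<omega> \<eta>)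
           (g_bar M1 M2 a f \<omega> \<eta> g1 g2)"
proof -
  interpret hermitian_contact_product M1 M2 J g1 \<omega> \<phi> \<xi> \<eta> g2 a f
    using assms by unfold_locales
  show ?thesis by (rule almost_contact_metric_prod)
qed

end
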